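(* Let $k\geq 4$ be an even integer and write $$G_k = \sum_{\substack{a,b\geq 0\\ 4a+6b=k}} w_{a,k}\, G_4^{a} G_6^{b}$$ with $w_{a,k}\in\mathbb{Q}$. Then $\min_a \nu_2(w_{a,k}) \geq 0$, i.e. $\nu_2(w_{a,k})\geq 0$ for every $a$.
   Context: For even $k\ge 4$, $E_k(z) = 1-\frac{2k}{B_k}\sum_{n\geq 1}\sigma_{k-1}(n)e^{2\pi i n z}$ is the normalized Eisenstein series of weight $k$ on $\mathrm{SL}_2(\mathbb{Z})$, $\zeta$ is the Riemann zeta function, and $G_k = 2\zeta(k)E_k$. The coefficients $w_{a,k}$ are uniquely determined since the monomials $G_4^aG_6^b$ with $4a+6b=k$ form a basis of the space of modular forms of weight $k$. For a prime $p$, $\nu_p$ is the $p$-adic valuation on $\mathbb{Q}$ with $\nu_p(0)=\infty$. *)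

theory Defs
  imports "HOL-Analysis.Analysis"
begin

text \<open>Bernoulli numbers B_0, B_1, ..., B_n (as a list), via the standard recursion
  sum_{j=0}^{n} (n+1 choose j) B_j = 0 for n >= 1, B_0 = 1.
  (The convention for B_1 is irrelevant here: only even indices are used.)\<close>
primrec bernoulli_list :: "nat \<Rightarrow> rat list" where
  "bernoulli_list 0 = [1]"
| "bernoulli_list (Suc n) =
     (let L = bernoulli_list n
      in L @ [- (\<Sum>j<length L. of_nat (Suc (Suc n) choose j) * L ! j) / of_nat (Suc (Suc n))])"

definition bernoulli :: "nat \<Rightarrow> rat" where
  "bernoulli n = last (bernoulli_list n)"

definition zeta_nat :: "nat \<Rightarrow> real" where
  "zeta_nat k = (\<Sum>n. 1 / (real (Suc n)) ^ k)"

definition divisor_sigma :: "nat \<Rightarrow> nat \<Rightarrow> nat" where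
  "divisor_sigma m n = (\<Sum>d\<in>{d. d dvd n}. d ^ m)"

definition eisenstein_E :: "nat \<Rightarrow> complex \<Rightarrow> complex" where
  "eisenstein_E k z = 1 - of_real (of_rat (2 * of_nat k / bernoulli k)) *
      (\<Sum>n. of_nat (divisor_sigma (k - 1) (Suc n)) * exp (2 * of_real pi * \<i> * of_nat (Suc n) * z))"

definition eisenstein_G :: "nat \<Rightarrow> complex \<Rightarrow> complex" where
  "eisenstein_G k z = of_real (2 * zeta_nat k) * eisenstein_E k z"

definition exps_46 :: "nat \<Rightarrow> nat set" where
  "exps_46 k = {a. 4 * a \<le> k \<and> 6 dvd (k - 4 * a)}"

definition G_expansion :: "nat \<Rightarrow> (nat \<Rightarrow> rat) \<Rightarrow> bool" where
  "G_expansion k w \<longleftrightarrow> (\<forall>z. Im z > 0 \<longrightarrow>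
     eisenstein_G k z = (\<Sum>a\<in>exps_46 k. of_rat (w a) * eisenstein_G 4 z ^ a * eisenstein_G 6 z ^ ((k - 4 * a) div 6)))"

text \<open>p-adic valuation of a nonzero rational (nu_p(0) = infinity is handled separately).\<close>
definition padic_val_rat :: "nat \<Rightarrow> rat \<Rightarrow> int" where
  "padic_val_rat p x = (case quotient_of x of (n, d) \<Rightarrow>
      int (multiplicity (int p) n) - int (multiplicity (int p) d))"

end

(*
  Up to the factor (2 pi i)^k, the numbers (k - 1) G_k(z) are the Taylor coefficients
  of t^2 wp(t), where, with w = exp t and q = exp(2 pi i z),
    wp(t) = w / (1 - w)^2 + 1/12 + sum_{n >= 1} n q^n / (1 - q^n) (w^n + w^(-n) - 2).
  Ramanujan's manipulation of Lambert series, based on u_m u_k = u_{m+k} (1 + u_m + u_k) for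
  u_n = q^n / (1 - q^n), shows that wp'' - 6 wp^2 is constant, with no theory of elliptic functions.
  Integrating once gives (wp')^2 / 4 = wp^3 - 15 G_4 wp - 35 G_6 after rescaling t. In this cubic equation the
  coefficient c_n = (2n - 1) G_{2n} is multiplied by the odd number 2n + 1 and everything else is a
  polynomial with integer coefficients in lower c_i, so 2-integrality follows by induction; the usual
  recurrence from wp'' = 6 wp^2 - 30 G_4 has the factor n - 3 instead, which may be even.
  Uniqueness: on the imaginary axis G_4 / G_6^(2/3) is strictly monotone near the cusp, so it takes infinitely
  many values, and a polynomial relation between G_4 and G_6 of fixed weight is a polynomial in this ratio.
*)
theory Submission
  imports Defs "HOL-Complex_Analysis.Complex_Analysis"
begin

text \<open>\<open>eisenstein_G\<close> carries the real series zeta(k), whereas the Lambert series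
  only produce B_k / k!; Euler's formula is proved so that the two agree up to (2 pi i)^k. Analysis
  in t is avoided: t^2 wp is a formal power series, each coefficient being an explicit number plus
  an absolutely convergent sum over n, so the only estimates are polynomial growth against |q|^n. No
  constant of integration has to be computed from q-series: the one in wp'' - 6 wp^2 sits at t^4 and
  is read off as a multiple of c_2, the one of the cubic sits at t^6, and these are the degrees of
  the generators c_2 = 3 G_4 and c_3 = 5 G_6. The odd factor arises because t^6 ((wp')^2 / 4 -
  wp^3), linearised at t^2 wp = 1, has coefficient -(2 (n - 1) + 3) c_n at t^(2n). The only
  denominators introduced are 2n + 1 in the induction and 2n - 1 in G_{2n} = c_n / (2n - 1).
  Uniqueness is needed since the claim concerns every \<open>w\<close> with
  \<open>G_expansion k w\<close>.\<close>

unbundle no vec_syntax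
unbundle fps_syntax

section \<open>Bernoulli numbers and even zeta values\<close>

lemma length_bernoulli_list: "length (bernoulli_list n) = Suc n"
  by (induction n) (auto simp: Let_def)

lemma nth_bernoulli_list: "j \<le> n \<Longrightarrow> bernoulli_list n ! j = bernoulli j"
proof (induction n)
  case 0
  then show ?case by (simp add: bernoulli_def)
next
  case (Suc n)
  show ?case
  proof (cases "j = Suc n")
    case True
    have "bernoulli_list (Suc n) \<noteq> []"
      using length_bernoulli_list[of "Suc n"] by force
    then show ?thesis
      using True length_bernoulli_list[of "Suc n"] by (simp add: bernoulli_def last_conv_nth)
  next
    case False
    then show ?thesis
      using Suc by (simp add: Let_def nth_append length_bernoulli_list)
  qed
qed

lemma bernoulli_0: "bernoulli 0 = 1"
  by (simp add: bernoulli_def)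

lemma bernoulli_Suc:
  "bernoulli (Suc n) = - (\<Sum>j\<le>n. of_nat (Suc (Suc n) choose j) * bernoulli j) / of_nat (Suc (Suc n))"
proof -
  have "(\<Sum>j<length (bernoulli_list n). of_nat (Suc (Suc n) choose j) * bernoulli_list n ! j) =
        (\<Sum>j\<le>n. of_nat (Suc (Suc n) choose j) * bernoulli j)"
    by (intro sum.cong) (auto simp: length_bernoulli_list nth_bernoulli_list)
  then show ?thesis
    by (simp add: bernoulli_def Let_def del: of_nat_Suc binomial_Suc_Suc)
qed

lemma sum_choose_bernoulli:
  "(\<Sum>j<m. of_nat (m choose j) * bernoulli j) = (if m = 1 then 1 else 0)"
proof (cases m)
  case 0
  then show ?thesis by simp
next
  case (Suc m')
  show ?thesis
  proof (cases m')
    case 0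
    then show ?thesis using Suc by (simp add: bernoulli_0)
  next
    case (Suc n)
    have m: "m = Suc (Suc n)" using Suc \<open>m = Suc m'\<close> by simp
    have "Suc (Suc n) choose Suc n = Suc (Suc n)"
      by (metis binomial_Suc_n)
    then show ?thesis
      unfolding m lessThan_Suc_atMost sum.atMost_Suc bernoulli_Suc
      by (simp del: of_nat_Suc binomial_Suc_Suc)
  qed
qed

text \<open>The Taylor series of t / (e^t - 1); the recursion gives B_1 = -1/2, which is the sign
  that fits this function.\<close>

definition bernoulli_fps :: "complex fps" where
  "bernoulli_fps = Abs_fps (\<lambda>n. of_rat (bernoulli n) / fact n)"

lemma bernoulli_fps_mult: "bernoulli_fps * (fps_exp 1 - 1) = fps_X"
proof (rule fps_ext)
  fix m
  have "(bernoulli_fps * (fps_exp 1 - 1)) $ m =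
     (\<Sum>j\<le>m. of_rat (bernoulli j) / fact j * (if j = m then 0 else 1 / fact (m - j)))"
    unfolding fps_mult_nth atLeast0AtMost
    by (intro sum.cong) (auto simp: bernoulli_fps_def)
  also have "\<dots> = (\<Sum>j<m. of_rat (bernoulli j) / fact j * (1 / fact (m - j)))"
    by (rule sum.mono_neutral_cong_right) auto
  also have "\<dots> = of_rat (\<Sum>j<m. of_nat (m choose j) * bernoulli j) / fact m"
    unfolding of_rat_sum sum_divide_distrib
    by (intro sum.cong) (auto simp: of_rat_mult binomial_fact[where 'a = complex] field_simps)
  also have "\<dots> = fps_X $ m"
    by (simp add: sum_choose_bernoulli fps_X_def)
  finally show "(bernoulli_fps * (fps_exp 1 - 1)) $ m = fps_X $ m" .
qed

section \<open>Euler's formula for even zeta values, via the digamma function\<close>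

text \<open>Off the integers sin(pi w) Gamma(w) Gamma(1 - w) is the constant pi, so its derivative
  vanishes; cancelling the nonzero Gamma factors leaves this relation.\<close>

lemma Digamma_reflection_complex:
  fixes z :: complex
  assumes "z \<notin> \<int>"
  shows "(Digamma z - Digamma (1 - z)) * sin (of_real pi * z) = - (of_real pi * cos (of_real pi * z))"
proof -
  have 1: "1 - z \<notin> \<int>"
  proof
    assume "1 - z \<in> \<int>"
    then have "1 - (1 - z) \<in> \<int>" by (intro Ints_diff) auto
    then show False using assms by simp
  qed
  have nz: "z \<notin> \<int>\<^sub>\<le>\<^sub>0" "1 - z \<notin> \<int>\<^sub>\<le>\<^sub>0"
    using assms 1 nonpos_Ints_Int by auto
  have s: "sin (of_real pi * w) * (Gamma w * Gamma (1 - w)) = of_real pi" if "w \<in> - \<int>" for w :: complex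
  proof -
    have "sin (of_real pi * w) \<noteq> 0"
    proof
      assume "sin (of_real pi * w) = 0"
      then obtain n :: int where "of_real pi * w = of_real (of_int n * pi)"
        by (auto simp: sin_eq_0)
      then have "w = of_int n" by simp
      then show False using that by simp
    qed
    then show ?thesis
      by (simp add: Gamma_reflection_complex)
  qed
  have D: "((\<lambda>w::complex. sin (of_real pi * w) * (Gamma w * Gamma (1 - w))) has_field_derivative
     (of_real pi * cos (of_real pi * z) * (Gamma z * Gamma (1 - z)) +
      (Gamma z * Digamma z * Gamma (1 - z) - Gamma z * (Gamma (1 - z) * Digamma (1 - z))) * sin (of_real pi * z))) (at z)"
    using nz by (auto intro!: derivative_eq_intros simp: algebra_simps)
  have "((\<lambda>w::complex. of_real pi :: complex) has_field_derivative
     (of_real pi * cos (of_real pi * z) * (Gamma z * Gamma (1 - z)) +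
      (Gamma z * Digamma z * Gamma (1 - z) - Gamma z * (Gamma (1 - z) * Digamma (1 - z))) * sin (of_real pi * z))) (at z)"
    by (rule has_field_derivative_transform_within_open[OF D, of "- \<int>"])
       (use assms s in \<open>auto simp: closed_of_int_image Ints_def open_Compl\<close>)
  then have "of_real pi * cos (of_real pi * z) * (Gamma z * Gamma (1 - z)) +
      (Gamma z * Digamma z * Gamma (1 - z) - Gamma z * (Gamma (1 - z) * Digamma (1 - z))) * sin (of_real pi * z) = 0"
    using DERIV_unique DERIV_const by blast
  then have "Gamma z * Gamma (1 - z) * (of_real pi * cos (of_real pi * z) + (Digamma z - Digamma (1 - z)) * sin (of_real pi * z)) = 0"
    by (simp add: algebra_simps)
  then have "of_real pi * cos (of_real pi * z) + (Digamma z - Digamma (1 - z)) * sin (of_real pi * z) = 0"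
    using nz by (simp add: Gamma_eq_zero_iff)
  then show ?thesis by (simp add: algebra_simps eq_neg_iff_add_eq_0)
qed


text \<open>Shifting by 1 moves the pole of Digamma away from 0. The whole half-plane is carried
  along because the induction differentiates an identity on an open set.\<close>

lemma higher_deriv_Digamma:
  "Re z > -1 \<Longrightarrow> (deriv ^^ n) (\<lambda>z. Digamma (1 + z)) z = Polygamma n (1 + z :: complex)"
proof (induction n arbitrary: z)
  case 0
  then show ?case by simp
next
  case (Suc n)
  have nz: "1 + w \<notin> \<int>\<^sub>\<le>\<^sub>0" if "Re w > -1" for w :: complex
    using that by (auto elim!: nonpos_Ints_cases simp: complex_eq_iff)
  have "((\<lambda>z. Polygamma n (1 + z)) has_field_derivative Polygamma (Suc n) (1 + z)) (at z)"
    using nz[OF Suc.prems] by (auto intro!: derivative_eq_intros)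
  then have "((deriv ^^ n) (\<lambda>z. Digamma (1 + z)) has_field_derivative Polygamma (Suc n) (1 + z)) (at z)"
    by (rule has_field_derivative_transform_within_open[of _ _ _ "{z. Re z > -1}"])
       (use Suc in \<open>auto simp: open_halfspace_Re_gt\<close>)
  then show ?case
    by (simp add: DERIV_imp_deriv)
qed

lemma Polygamma_1_eq_zeta:
  assumes "n > 0"
  shows "Polygamma n (1 :: complex) = (-1) ^ Suc n * fact n * of_real (zeta_nat (Suc n))"
proof -
  have s: "summable (\<lambda>k. 1 / real (Suc k) ^ Suc n)"
    using summable_Suc_iff[of "\<lambda>k. inverse (real k ^ Suc n)"] inverse_power_summable[of "Suc n"] assms
    by (simp add: inverse_eq_divide)
  have "(\<Sum>k. inverse ((1 + of_nat k :: complex) ^ Suc n)) = (\<Sum>k. of_real (1 / real (Suc k) ^ Suc n))"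
    by (intro suminf_cong) (simp add: inverse_eq_divide)
  also have "\<dots> = of_real (zeta_nat (Suc n))"
    unfolding zeta_nat_def by (rule suminf_of_real[OF s, symmetric])
  finally show ?thesis
    using assms by (simp add: Polygamma_def)
qed

text \<open>Both sides are the Taylor series of pi t cot(pi t): the left one through t (Digamma(1 +
  t) - Digamma(1 - t)), the right one through 2 pi i t / (e^(2 pi i t) - 1), whose linear term is
  cancelled by the summand pi i t. The proof works with multiples of sin(pi t) and cancels that
  factor only at the end.\<close>

lemma zeta_bernoulli_fps:
  defines "Q \<equiv> Abs_fps (\<lambda>k. if even k \<and> k > 0 then of_real (2 * zeta_nat k) else 0 :: complex)"
  shows "1 - Q = (bernoulli_fps oo (fps_const (2 * of_real pi * \<i>) * fps_X)) + fps_const (of_real pi * \<i>) * fps_X"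
proof -
  define P where "P = fps_expansion (\<lambda>z. Digamma (1 + z)) 0"
  define c :: complex where "c = of_real pi"
  have P: "(\<lambda>z. Digamma (1 + z)) has_fps_expansion P"
    unfolding P_def
    by (rule has_fps_expansion_fps_expansion[of "{z. Re z > -1}"])
      (auto simp: open_halfspace_Re_gt holomorphic_on_open
        intro!: exI derivative_eq_intros elim!: nonpos_Ints_cases simp: complex_eq_iff)
  have P': "(\<lambda>z. Digamma (1 - z)) has_fps_expansion (P oo (- fps_X))"
    using has_fps_expansion_compose[OF P has_fps_expansion_minus[OF has_fps_expansion_fps_X]]
    by (simp add: o_def)
  have Pn: "P $ n = (-1) ^ Suc n * of_real (zeta_nat (Suc n))" if "n > 0" for n
    using that by (simp add: P_def fps_expansion_def higher_deriv_Digamma Polygamma_1_eq_zeta)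
  \<comment> \<open>The difference kills the coefficients of \<open>P\<close> of even index, among
    them the constant term Digamma(1), which is not a zeta value.\<close>
  have Q: "Q = fps_X * (P - (P oo (- fps_X)))"
  proof (rule fps_ext)
    fix k
    show "Q $ k = (fps_X * (P - (P oo (- fps_X)))) $ k"
    proof (cases "k \<le> 1")
      case True
      then show ?thesis by (cases k) (auto simp: Q_def fps_compose_uminus')
    next
      case False
      then obtain j where "k = Suc j" "j > 0" by (cases k) auto
      then show ?thesis by (auto simp: Q_def fps_compose_uminus' Pn)
    qed
  qed
  have "(\<lambda>z. sin (c * z) * (1 - z * (Digamma (1 + z) - Digamma (1 - z)))) has_fps_expansion fps_sin c * (1 - Q)"
    unfolding Q by (intro fps_expansion_intros P P')
  also have "?this \<longleftrightarrow> (\<lambda>z. c * z * cos (c * z)) has_fps_expansion fps_sin c * (1 - Q)"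
  proof (rule has_fps_expansion_cong)
    have "eventually (\<lambda>z::complex. z \<in> ball 0 1) (nhds 0)"
      by (rule eventually_nhds_in_open) auto
    then show "\<forall>\<^sub>F z in nhds 0. sin (c * z) * (1 - z * (Digamma (1 + z) - Digamma (1 - z))) = c * z * cos (c * z)"
    proof eventually_elim
      case (elim z)
      show ?case
      proof (cases "z = 0")
        case False
        have z: "z \<notin> \<int>"
        proof
          assume "z \<in> \<int>"
          then obtain n :: int where "z = of_int n" by (auto elim: Ints_cases)
          then show False using elim False by auto
        qed
        have "Digamma (1 + z) = Digamma z + 1 / z"
          using Digamma_plus1[OF False] by (simp add: add.commute)
        moreover have "(Digamma z - Digamma (1 - z)) * sin (c * z) = - (c * cos (c * z))"
          unfolding c_def by (rule Digamma_reflection_complex[OF z])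
        moreover have "sin (c * z) * (1 - z * (Digamma z + 1 / z - Digamma (1 - z))) =
            - z * ((Digamma z - Digamma (1 - z)) * sin (c * z))"
          using False by (simp add: field_simps)
        ultimately show ?thesis by simp
      qed auto
    qed
  qed auto
  finally have 1: "(\<lambda>z. c * z * cos (c * z)) has_fps_expansion fps_sin c * (1 - Q)" .
  have 2: "(\<lambda>z. c * z * cos (c * z)) has_fps_expansion fps_const c * fps_X * fps_cos c"
    by (intro fps_expansion_intros)
  have sQ: "fps_sin c * (1 - Q) = fps_const c * fps_X * fps_cos c"
    using fps_expansion_unique_complex[OF 1 2] .
  define e where "e = fps_exp (\<i> * c)"
  define e' where "e' = fps_exp (- (\<i> * c))"
  define B where "B = bernoulli_fps oo (fps_const (2 * c * \<i>) * fps_X)"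
  have ee': "e * e' = 1"
    by (simp add: e_def e'_def flip: fps_exp_add_mult)
  have "(bernoulli_fps * (fps_exp 1 - 1)) oo (fps_const (2 * c * \<i>) * fps_X) = fps_X oo (fps_const (2 * c * \<i>) * fps_X)"
    by (simp add: bernoulli_fps_mult)
  then have "B * (fps_exp (2 * c * \<i>) - 1) = fps_const (2 * c * \<i>) * fps_X"
    by (simp add: fps_compose_mult_distrib fps_compose_sub_distrib B_def)
  also have "fps_exp (2 * c * \<i>) = e * e"
    by (simp add: e_def algebra_simps flip: fps_exp_add_mult)
  finally have Be: "B * (e * e - 1) = fps_const (2 * c * \<i>) * fps_X" .
  define j where "j = fps_const \<i>"
  define C where "C = fps_const c"
  have jj: "j * j = -1"
    by (simp add: j_def fps_const_mult fps_const_neg flip: fps_const_1_eq_1)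
  have e: "e = fps_cos c + j * fps_sin c" and e': "e' = fps_cos c - j * fps_sin c"
    using fps_exp_ii_sin_cos[of c] fps_exp_minus_ii_sin_cos[of c] by (simp_all add: e_def e'_def j_def)
  have C2: "fps_const (2 * c * \<i>) = 2 * C * j"
    by (simp add: C_def j_def numeral_fps_const)
  have C1: "fps_const (c * \<i>) = C * j"
    by (simp add: C_def j_def)
  have "fps_sin c * (B + fps_const (c * \<i>) * fps_X) = fps_const c * fps_X * fps_cos c"
  proof -
    have "e - e' = 2 * j * fps_sin c"
      by (simp add: e e')
    then have "2 * j * (fps_sin c * B) = e' * (B * (e * e - 1))"
      using ee' by algebra
    also have "\<dots> = 2 * j * (C * fps_X * e')"
      unfolding Be C2 by (simp add: algebra_simps)
    finally have "fps_sin c * B = C * fps_X * e'"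
      using jj by force
    then show ?thesis
      unfolding C1 e' C_def[symmetric] by (simp add: algebra_simps)
  qed
  then have "fps_sin c * (1 - Q) = fps_sin c * (B + fps_const (c * \<i>) * fps_X)"
    using sQ by simp
  moreover have "fps_sin c \<noteq> 0"
  proof
    assume "fps_sin c = 0"
    then have "fps_sin c $ 1 = 0" by simp
    then show False by (simp add: c_def)
  qed
  ultimately show ?thesis
    by (simp add: B_def c_def)
qed

text \<open>Compare coefficients beyond the linear term. Both parities are kept: the odd case is the
  vanishing of the odd Bernoulli numbers.\<close>

lemma bernoulli_eq_zeta:
  assumes "k \<ge> 2"
  shows "of_rat (bernoulli k) * (2 * of_real pi * \<i>) ^ k / fact k =
    (if even k then - of_real (2 * zeta_nat k) else 0 :: complex)"
proof -
  have "(1 - Abs_fps (\<lambda>k. if even k \<and> k > 0 then of_real (2 * zeta_nat k) else 0 :: complex)) $ k =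
     ((bernoulli_fps oo (fps_const (2 * of_real pi * \<i>) * fps_X)) + fps_const (of_real pi * \<i>) * fps_X) $ k"
    by (simp only: zeta_bernoulli_fps)
  moreover have "k \<noteq> 0" "k \<noteq> 1" "k \<noteq> Suc 0" using assms by auto
  moreover have "bernoulli_fps $ k = of_rat (bernoulli k) / fact k"
    by (simp add: bernoulli_fps_def)
  ultimately show ?thesis
    by (auto simp: mult.commute[of "of_rat _"] fps_X_nth)
qed

lemma bernoulli_odd: "odd k \<Longrightarrow> k > 1 \<Longrightarrow> bernoulli k = 0"
  using bernoulli_eq_zeta[of k] by simp

lemma zeta_nat_pos:
  assumes "k \<ge> 2"
  shows "zeta_nat k > 0"
proof -
  have s: "summable (\<lambda>n. 1 / real (Suc n) ^ k)"
    using summable_Suc_iff[of "\<lambda>n. inverse (real n ^ k)"] inverse_power_summable[of k] assms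
    by (simp add: inverse_eq_divide)
  show ?thesis
    unfolding zeta_nat_def by (rule suminf_pos[OF s]) auto
qed

text \<open>Positivity of zeta(k) in Euler's formula. It makes the quotient 2k / B_k in
  \<open>eisenstein_E\<close> a genuine one.\<close>

lemma bernoulli_even_nonzero:
  assumes "even k"
  shows "bernoulli k \<noteq> 0"
proof (cases "k = 0")
  case False
  then have "k \<ge> 2" using assms by (cases "k = 1") auto
  with bernoulli_eq_zeta[of k] zeta_nat_pos[of k] assms show ?thesis
    by auto
qed (simp add: bernoulli_0)

section \<open>Ramanujan's Lambert series identity\<close>

lemma summable_power_mult_geometric:
  fixes x :: real
  assumes "\<bar>x\<bar> < 1"
  shows "summable (\<lambda>n. real n ^ j * x ^ n)"
  using assms
proof (induction j arbitrary: x)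
  case 0
  then show ?case by (simp add: summable_geometric)
next
  case (Suc j)
  have "summable (\<lambda>n. diffs (\<lambda>n. real n ^ j) n * x ^ n)"
    by (rule termdiff_converges[where K = 1]) (use Suc in auto)
  then have "summable (\<lambda>n. x * (diffs (\<lambda>n. real n ^ j) n * x ^ n))"
    by (rule summable_mult)
  then have "summable (\<lambda>n. real (Suc n) ^ Suc j * x ^ Suc n)"
    by (simp add: diffs_def mult_ac)
  then show ?case
    by (subst (asm) summable_Suc_iff)
qed

section \<open>Rearrangement of double series\<close>

lemma infsum_eq_suminf_nat: "f summable_on (UNIV :: nat set) \<Longrightarrow> infsum f UNIV = suminf f"
  for f :: "nat \<Rightarrow> complex"
  by (metis has_sum_imp_sums has_sum_infsum sums_unique)

lemma has_sum_diff:
  fixes f g :: "'a \<Rightarrow> complex"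
  assumes "(f has_sum x) A" "(g has_sum y) A"
  shows "((\<lambda>a. f a - g a) has_sum (x - y)) A"
  using has_sum_add[OF assms(1), of "\<lambda>a. - g a" "- y"] assms(2) by (simp add: has_sum_uminus)

lemma summable_on_diff:
  "f summable_on A \<Longrightarrow> g summable_on A \<Longrightarrow> (\<lambda>a. f a - g a :: complex) summable_on A"
  unfolding summable_on_def using has_sum_diff by blast

lemma infsum_diff:
  "f summable_on A \<Longrightarrow> g summable_on A \<Longrightarrow> (\<Sum>\<^sub>\<infinity>a\<in>A. f a - g a :: complex) = infsum f A - infsum g A"
  by (intro infsumI has_sum_diff) auto

lemma has_sum_iterated:
  fixes F :: "nat \<times> nat \<Rightarrow> complex"
  assumes "F summable_on UNIV"
  shows "((\<lambda>k. \<Sum>\<^sub>\<infinity>m. F (k, m)) has_sum infsum F UNIV) UNIV"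
proof -
  have s: "(\<lambda>(x, y). F (x, y)) summable_on (SIGMA x:UNIV. UNIV)"
    using assms by simp
  show ?thesis
    using infsum_Sigma'_banach[OF s] summable_on_Sigma_banach[OF s]
    by (simp add: has_sum_iff)
qed

lemma has_sum_antidiagonal:
  fixes F :: "nat \<times> nat \<Rightarrow> complex"
  assumes "F summable_on UNIV"
  shows "((\<lambda>n. \<Sum>k\<le>n. F (k, n - k)) has_sum infsum F UNIV) UNIV"
proof -
  let ?A = "SIGMA n:(UNIV :: nat set). {..n}"
  have "(F has_sum infsum F UNIV) UNIV"
    using assms by simp
  also have "?this \<longleftrightarrow> ((\<lambda>(n, k). F (k, n - k)) has_sum infsum F UNIV) ?A"
    by (rule has_sum_reindex_bij_witness[of _ "\<lambda>(n, k). (k, n - k)" "\<lambda>(k, m). (k + m, k)"]) auto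
  finally have h: "((\<lambda>(n, k). F (k, n - k)) has_sum infsum F UNIV) ?A" .
  have s: "(\<lambda>(n, k). F (k, n - k)) summable_on ?A"
    using h by (rule has_sum_imp_summable)
  show ?thesis
    using infsum_Sigma'_banach[OF s] summable_on_Sigma_banach[OF s] infsumI[OF h]
    by (simp add: has_sum_iff)
qed

text \<open>Regrouping by k = |n - m|. Symmetry exchanges the two triangles, and the zero diagonal
  lets it be counted in either of them, whence the uniform factor 2, including k = 0.\<close>

lemma has_sum_distance:
  fixes G :: "nat \<Rightarrow> nat \<Rightarrow> complex"
  assumes sym: "\<And>n m. G n m = G m n" and diag: "\<And>n. G n n = 0"
    and s: "(\<lambda>(n, m). G n m) summable_on UNIV"
  shows "((\<lambda>k. 2 * (\<Sum>\<^sub>\<infinity>m. G m (m + k))) has_sum (\<Sum>\<^sub>\<infinity>(n, m). G n m)) UNIV"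
proof -
  let ?U = "{(n, m). n \<le> (m :: nat)}" and ?L = "{(n, m). n > (m :: nat)}"
  let ?G = "\<lambda>(n, m). G n m"
  have sU: "?G summable_on ?U" and sL: "?G summable_on ?L"
    by (rule summable_on_subset_banach[OF s]; simp)+
  have sD: "(\<lambda>(k, m). G m (m + k)) summable_on UNIV"
    using sU by (subst summable_on_reindex_bij_witness[of _ "\<lambda>(n, m). (m - n, n)" "\<lambda>(k, m). (m, m + k)" ?U]) auto
  have "infsum ?G ?U = (\<Sum>\<^sub>\<infinity>(k, m). G m (m + k))"
    by (rule infsum_reindex_bij_witness[of _ "\<lambda>(k, m). (m, m + k)" "\<lambda>(n, m). (m - n, n)"]) auto
  moreover have "infsum ?G ?L = infsum ?G {(n, m). n < (m :: nat)}"
    by (rule infsum_reindex_bij_witness[of _ "\<lambda>(n, m). (m, n)" "\<lambda>(n, m). (m, n)"]) (auto simp: sym)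
  moreover have "infsum ?G {(n, m). n < (m :: nat)} = infsum ?G ?U"
    by (rule infsum_cong_neutral) (auto simp: diag dest: le_neq_implies_less)
  moreover have "infsum ?G UNIV = infsum ?G ?U + infsum ?G ?L"
    by (subst infsum_Un_disjoint[OF sU sL, symmetric]) (auto intro!: infsum_cong_neutral)
  ultimately have "infsum ?G UNIV = 2 * (\<Sum>\<^sub>\<infinity>(k, m). G m (m + k))"
    by simp
  with has_sum_cmult_right[OF has_sum_iterated[OF sD], of 2] show ?thesis
    by simp
qed

lemma sum_index_mult_complement:
  "(\<Sum>n\<le>k. of_nat n * (of_nat k - of_nat n)) = (of_nat k ^ 3 - of_nat k :: complex) / 6"
proof -
  \<comment> \<open>The constant \<open>c\<close> is decoupled from the upper limit so that
    induction on \<open>k\<close> leaves the summand unchanged.\<close>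
  have "6 * (\<Sum>n\<le>k. of_nat n * (c - of_nat n)) =
      of_nat k * (of_nat k + 1) * (3 * c - 2 * of_nat k - 1 :: complex)" for c
    by (induction k) (simp_all add: algebra_simps)
  from this[of "of_nat k"] show ?thesis
    by (simp add: algebra_simps power3_eq_cube)
qed

locale nome =
  fixes q :: complex
  assumes norm_q: "norm q < 1"
begin

text \<open>At n = 0 this is 1 / 0 = 0, so sums over all naturals effectively start at n =
  1.\<close>

definition u :: "nat \<Rightarrow> complex" where
  "u n = q ^ n / (1 - q ^ n)"

definition b :: "nat \<Rightarrow> complex" where
  "b n = of_nat n * u n"

text \<open>The common majorant of all series below. The base n + 1 makes it increasing in
  \<open>J\<close> even at n = 0, and n + m + 1 \<le> (n + 1) (m + 1) splits bounds for double
  series into products.\<close>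

definition maj :: "nat \<Rightarrow> nat \<Rightarrow> real" where
  "maj J n = real (n + 1) ^ J * norm q ^ n"

lemma u_0: "u 0 = 0" and b_0: "b 0 = 0"
  by (simp_all add: u_def b_def)

lemma power_q_neq_1: "n > 0 \<Longrightarrow> q ^ n \<noteq> 1"
  using norm_q power_less_one_iff[of "norm q" n] by (metis less_irrefl norm_ge_zero norm_one norm_power)

text \<open>For q nonzero, 1 + 1 / u_n = q^(-n) is multiplicative in n; this is that fact cleared of
  denominators.\<close>

lemma u_mult:
  assumes "m > 0" "k > 0"
  shows "u m * u k = u (m + k) * (1 + u m + u k)"
  using power_q_neq_1[of m] power_q_neq_1[of k] power_q_neq_1[of "m + k"] assms
  by (simp add: u_def power_add divide_simps) (simp add: algebra_simps)

lemma norm_u_le: "norm (u n) \<le> norm q ^ n / (1 - norm q)"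
proof (cases "n = 0")
  case True
  then show ?thesis using norm_q by (simp add: u_0)
next
  case False
  have "norm q ^ n \<le> norm q"
    using False norm_q power_decreasing[of 1 n "norm q"] by simp
  moreover have "norm (1 - q ^ n) \<ge> 1 - norm q ^ n"
    by (metis norm_one norm_power norm_triangle_ineq2)
  ultimately have "1 - norm q \<le> norm (1 - q ^ n)" by linarith
  then show ?thesis
    unfolding u_def norm_divide norm_power using norm_q by (intro divide_left_mono mult_pos_pos) auto
qed

lemma maj_nonneg: "maj J n \<ge> 0"
  by (simp add: maj_def)

lemma maj_mono: "J \<le> J' \<Longrightarrow> maj J n \<le> maj J' n"
  unfolding maj_def by (intro mult_right_mono power_increasing) auto

lemma summable_maj: "summable (maj J)"
proof -
  have "summable (\<lambda>n. 2 ^ J * (real n ^ J * norm q ^ n) + norm q ^ n)"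
    using norm_q by (intro summable_add summable_mult summable_power_mult_geometric) (auto simp: summable_geometric)
  then show ?thesis
  proof (rule summable_comparison_test'[where N = 0])
    fix n :: nat
    have "real (n + 1) ^ J \<le> 2 ^ J * real n ^ J + 1"
    proof (cases "n = 0")
      case False
      then have "real (n + 1) ^ J \<le> (2 * real n) ^ J"
        by (intro power_mono) auto
      then show ?thesis by (simp add: power_mult_distrib)
    qed simp
    then have "real (n + 1) ^ J * norm q ^ n \<le> (2 ^ J * real n ^ J + 1) * norm q ^ n"
      by (rule mult_right_mono) simp
    then show "norm (maj J n) \<le> 2 ^ J * (real n ^ J * norm q ^ n) + norm q ^ n"
      by (simp add: maj_def algebra_simps)
  qed
qed

lemma norm_u_le_maj: "norm (of_nat n ^ j * u n) \<le> maj j n / (1 - norm q)"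
proof -
  have "real n ^ j \<le> real (n + 1) ^ j" by (intro power_mono) auto
  then have "real n ^ j * norm (u n) \<le> real (n + 1) ^ j * (norm q ^ n / (1 - norm q))"
    using norm_u_le by (intro mult_mono) auto
  then show ?thesis by (simp add: maj_def norm_mult norm_power)
qed

lemma summable_on_maj:
  assumes "\<And>n. norm (f n) \<le> M * maj J n"
  shows "(f :: nat \<Rightarrow> complex) summable_on UNIV"
proof (rule norm_summable_imp_summable_on)
  show "summable (\<lambda>n. norm (f n))"
    by (rule summable_comparison_test'[OF summable_mult[OF summable_maj], where N = 0]) (use assms in auto)
qed

lemma summable_on_maj2:
  fixes F :: "nat \<times> nat \<Rightarrow> complex"
  assumes "\<And>n m. norm (F (n, m)) \<le> M * (maj J n * maj J m)"
  shows "F summable_on UNIV"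
proof -
  have s: "maj J summable_on UNIV"
    using summable_maj by (subst summable_on_UNIV_nonneg_real_iff) (auto simp: maj_nonneg)
  let ?g = "\<lambda>(n, m). M * (maj J n * maj J m)"
  have "(\<lambda>x. norm (?g x)) summable_on UNIV \<times> UNIV"
    by (rule Infinite_Sum.abs_summable_on_Sigma_iff[THEN iffD2])
       (use s in \<open>auto simp: abs_mult maj_nonneg infsum_cmult_right' intro!: summable_on_cmult_right summable_on_cmult_left\<close>)
  then have "(\<lambda>x. norm (F x)) summable_on UNIV \<times> UNIV"
    by (rule Infinite_Sum.abs_summable_on_comparison_test) (use assms in \<open>auto intro: order_trans[OF _ abs_ge_self]\<close>)
  then show ?thesis
    using abs_summable_summable by simp
qed

lemma summable_on_u: "(\<lambda>n. of_nat n ^ j * u n) summable_on UNIV"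
  by (rule summable_on_maj[of _ "1 / (1 - norm q)" j]) (use norm_u_le_maj[of _ j] in auto)

text \<open>Apply \<open>u_mult\<close> to each pair n, k - n. The summand 1 in it gives the cubic
  in k, and the other two give equal sums under n -> k - n.\<close>

lemma sum_b_b:
  assumes "k > 0"
  shows "(\<Sum>n\<le>k. b n * b (k - n)) =
    u k * ((of_nat k ^ 3 - of_nat k) / 6 + 2 * (\<Sum>n\<le>k. of_nat n * (of_nat k - of_nat n) * u n))"
proof -
  have "(\<Sum>n\<le>k. b n * b (k - n)) =
      (\<Sum>n\<le>k. u k * (of_nat n * (of_nat k - of_nat n) * (1 + u n + u (k - n))))"
  proof (rule sum.cong)
    fix n assume "n \<in> {..k}"
    show "b n * b (k - n) = u k * (of_nat n * (of_nat k - of_nat n) * (1 + u n + u (k - n)))"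
    proof (cases "n = 0 \<or> n = k")
      case False
      then have "u n * u (k - n) = u k * (1 + u n + u (k - n))"
        using u_mult[of n "k - n"] \<open>n \<in> {..k}\<close> by simp
      then show ?thesis
        using \<open>n \<in> {..k}\<close> by (simp add: b_def of_nat_diff)
    qed (auto simp: b_0)
  qed simp
  also have "\<dots> = u k * ((\<Sum>n\<le>k. of_nat n * (of_nat k - of_nat n)) +
      (\<Sum>n\<le>k. of_nat n * (of_nat k - of_nat n) * u n) +
      (\<Sum>n\<le>k. of_nat n * (of_nat k - of_nat n) * u (k - n)))"
    unfolding sum_distrib_left sum.distrib[symmetric] by (intro sum.cong) (simp_all add: algebra_simps)
  also have "(\<Sum>n\<le>k. of_nat n * (of_nat k - of_nat n) * u (k - n)) =
      (\<Sum>n\<le>k. of_nat n * (of_nat k - of_nat n) * u n)"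
    by (rule sum.reindex_bij_witness[of _ "\<lambda>n. k - n" "\<lambda>n. k - n"]) (auto simp: of_nat_diff)
  finally show ?thesis
    by (simp add: sum_index_mult_complement)
qed

text \<open>By \<open>u_mult\<close>, u_{m+k} (1 + u_m) = u_k (u_m - u_{m+k}), so the two series
  together become u_k times a difference of f(m) and g(m + k) that nearly telescopes: f - g is 2k b,
  and shifting g by k costs the finite sum over m < k.\<close>

lemma sum_b_shift:
  assumes "k > 0"
  shows "(\<Sum>\<^sub>\<infinity>m. of_nat m * b (m + k)) + (\<Sum>\<^sub>\<infinity>m. b m * b (m + k)) =
    u k * (2 * of_nat k * infsum b UNIV - (\<Sum>n\<le>k. of_nat n * (of_nat k - of_nat n) * u n))"
proof -
  define f where "f m = of_nat m * (of_nat m + of_nat k) * u m" for m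
  define g where "g m = of_nat m * (of_nat m - of_nat k) * u m" for m
  have f: "f summable_on UNIV" and g: "g summable_on UNIV"
  proof -
    have "(\<lambda>m. of_nat m ^ 2 * u m + of_nat k * (of_nat m ^ 1 * u m)) summable_on UNIV"
      "(\<lambda>m. of_nat m ^ 2 * u m + (- of_nat k) * (of_nat m ^ 1 * u m)) summable_on UNIV"
      by (intro summable_on_add summable_on_cmult_right summable_on_u)+
    then show "f summable_on UNIV" "g summable_on UNIV"
      by (simp_all add: f_def[abs_def] g_def[abs_def] algebra_simps power2_eq_square)
  qed
  have gk: "(\<lambda>m. g (m + k)) summable_on UNIV"
    using summable_on_subset_banach[OF g, of "{k..}"]
    by (subst summable_on_reindex_bij_witness[of _ "\<lambda>m. m - k" "\<lambda>m. m + k" "{k..}"]) auto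
  have "infsum g UNIV = (\<Sum>\<^sub>\<infinity>m. g (m + k)) + (\<Sum>m<k. g m)"
    unfolding infsum_eq_suminf_nat[OF g] infsum_eq_suminf_nat[OF gk]
    by (rule suminf_split_initial_segment) (rule summable_on_imp_summable[OF g])
  moreover have "(\<Sum>m<k. g m) = - (\<Sum>n\<le>k. of_nat n * (of_nat k - of_nat n) * u n)"
    unfolding sum_negf[symmetric] lessThan_Suc_atMost[symmetric]
    by (simp add: g_def) (auto intro!: sum.cong simp: algebra_simps)
  moreover have "infsum f UNIV - infsum g UNIV = 2 * of_nat k * infsum b UNIV"
  proof -
    have "infsum f UNIV - infsum g UNIV = (\<Sum>\<^sub>\<infinity>m. f m - g m)"
      using infsum_diff[OF f g] by simp
    also have "\<dots> = (\<Sum>\<^sub>\<infinity>m. 2 * of_nat k * b m)"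
      by (intro infsum_cong) (simp add: f_def g_def b_def algebra_simps)
    finally show ?thesis
      by (simp add: infsum_cmult_right')
  qed
  moreover have "(\<Sum>\<^sub>\<infinity>m. of_nat m * b (m + k)) + (\<Sum>\<^sub>\<infinity>m. b m * b (m + k)) =
      u k * (infsum f UNIV - (\<Sum>\<^sub>\<infinity>m. g (m + k)))"
  proof -
    have s1: "(\<lambda>m. of_nat m * b (m + k)) summable_on UNIV"
      using gk by (simp add: g_def b_def algebra_simps)
    have e: "of_nat m * b (m + k) + b m * b (m + k) = u k * (f m - g (m + k))" for m
    proof (cases "m = 0")
      case False
      then have "u m * u k = u (m + k) * (1 + u m + u k)"
        using u_mult assms by simp
      then show ?thesis
        by (simp add: b_def f_def g_def) algebra
    qed (simp add: b_def f_def g_def)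
    have "b m * b (m + k) = u k * (f m - g (m + k)) - of_nat m * b (m + k)" for m
      using e[of m] by (simp add: algebra_simps)
    then have s2: "(\<lambda>m. b m * b (m + k)) summable_on UNIV"
      by (simp add: summable_on_diff summable_on_cmult_right f gk s1)
    show ?thesis
      by (simp add: e infsum_cmult_right' infsum_diff[OF f gk] flip: infsum_add[OF s1 s2])
  qed
  ultimately show ?thesis
    by algebra
qed

text \<open>The finite sum of n (k - n) u_n, which has no closed form, enters with weight 12 from
  \<open>sum_b_shift\<close> and -12 from \<open>sum_b_b\<close>. The terms in
  \<open>infsum b UNIV\<close> and the cubic in k cancel as well.\<close>

lemma ramanujan_coefficient:
  assumes "k > 0"
  shows "of_nat k ^ 2 * b k - 12 * (\<Sum>\<^sub>\<infinity>m. of_nat m * b (m + k)) - b k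
    - 6 * ((\<Sum>n\<le>k. b n * b (k - n)) + 2 * (\<Sum>\<^sub>\<infinity>m. b m * b (m + k)) - 4 * infsum b UNIV * b k) = 0"
proof -
  have "of_nat k ^ 2 * b k - 12 * A1 - b k - 6 * (B + 2 * A3 - 4 * S * b k) =
      u k * (of_nat k ^ 3 - of_nat k + 24 * S * of_nat k) - 12 * (A1 + A3) - 6 * B" for A1 A3 B S
    by (simp add: b_def algebra_simps power2_eq_square power3_eq_cube)
  moreover have "u k * (of_nat k ^ 3 - of_nat k + 24 * S * of_nat k) - 12 * (u k * (2 * of_nat k * S - X))
      - 6 * (u k * ((of_nat k ^ 3 - of_nat k) / 6 + 2 * X)) = 0" for S X
    by (simp add: field_simps)
  ultimately show ?thesis
    by (simp only: sum_b_shift[OF assms] sum_b_b[OF assms])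
qed

lemma norm_b_le: "norm (b n) \<le> 1 / (1 - norm q) * (real (n + 1) * norm q ^ n)"
  using norm_u_le_maj[of n 1] by (simp add: b_def maj_def)

text \<open>The index function \<open>l\<close> serves both n + m and |n - m|, the two indices of
  the product-to-sum formula.\<close>

lemma summable_on_b_b:
  fixes c :: "nat \<Rightarrow> complex"
  assumes c: "\<And>n. norm (c n) \<le> M * real (n + 1) ^ J" and l: "\<And>n m. l n m \<le> n + m"
  shows "(\<lambda>(n, m). b n * b m * c (l n m)) summable_on UNIV"
proof (rule summable_on_maj2[of _ "1 / (1 - norm q) * (1 / (1 - norm q)) * M" "Suc J"])
  fix n m
  define r where "r = 1 / (1 - norm q)"
  have r: "r > 0" using norm_q by (simp add: r_def)
  have M: "M \<ge> 0"
    using order_trans[OF norm_ge_zero c[of 0]] by simp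
  have "real (l n m + 1) \<le> real (n + 1) * real (m + 1)"
  proof -
    have "l n m + 1 \<le> (n + 1) * (m + 1)"
      using l[of n m] by (simp add: algebra_simps)
    then show ?thesis
      by (metis of_nat_le_iff of_nat_mult)
  qed
  then have "M * real (l n m + 1) ^ J \<le> M * (real (n + 1) * real (m + 1)) ^ J"
    using M by (intro mult_left_mono power_mono) auto
  then have "norm (c (l n m)) \<le> M * (real (n + 1) * real (m + 1)) ^ J"
    using c[of "l n m"] by linarith
  then have "norm (b n * b m * c (l n m)) \<le> (r * (real (n + 1) * norm q ^ n)) * (r * (real (m + 1) * norm q ^ m)) *
       (M * (real (n + 1) * real (m + 1)) ^ J)"
    unfolding norm_mult using norm_b_le[of n] norm_b_le[of m] r M
    by (intro mult_mono) (auto simp: r_def)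
  then show "norm (case (n, m) of (n, m) \<Rightarrow> b n * b m * c (l n m)) \<le>
      1 / (1 - norm q) * (1 / (1 - norm q)) * M * (maj (Suc J) n * maj (Suc J) m)"
    by (simp add: maj_def r_def power_mult_distrib mult_ac)
qed

text \<open>The test sequence \<open>c\<close> will be a fixed Taylor coefficient of w^n + w^(-n).
  Regrouping every series by the index of \<open>c\<close> leaves at c(k) exactly the expression of
  \<open>ramanujan_coefficient\<close>; k = 0 is covered by c(0) = 0.\<close>

theorem ramanujan_identity:
  fixes c :: "nat \<Rightarrow> complex"
  assumes c0: "c 0 = 0" and c: "\<And>n. norm (c n) \<le> M * real (n + 1) ^ J"
  shows "(\<Sum>\<^sub>\<infinity>n. b n * (of_nat n ^ 2 * c n))
    - 12 * (\<Sum>\<^sub>\<infinity>n. b n * (\<Sum>k\<le>n. of_nat (n - k) * c k)) - (\<Sum>\<^sub>\<infinity>n. b n * c n)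
    - 6 * ((\<Sum>\<^sub>\<infinity>(n, m). b n * b m * c (n + m))
         + (\<Sum>\<^sub>\<infinity>(n, m). b n * b m * c (if n \<le> m then m - n else n - m))
         - 4 * infsum b UNIV * (\<Sum>\<^sub>\<infinity>n. b n * c n)) = 0"
proof -
  have M: "M \<ge> 0"
    using order_trans[OF norm_ge_zero c[of 0]] by simp
  define S where "S = infsum b UNIV"
  define d where "d n m = (if n \<le> m then m - n else n - m)" for n m :: nat
  define F1 where "F1 = (\<lambda>(k, m). of_nat m * b (m + k) * c k)"
  define F2 where "F2 = (\<lambda>(n, m). b n * b m * c (n + m))"
  define r where "r = 1 / (1 - norm q)"
  have r: "r > 0" using norm_q by (simp add: r_def)
  have nb: "norm (b n) \<le> r * (real (n + 1) * norm q ^ n)" for n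
    using norm_b_le by (simp add: r_def)
  have prod: "real (n + m + 1) \<le> real (n + 1) * real (m + 1)" for n m
    by (simp add: algebra_simps)
  have s3: "(\<lambda>(n, m). b n * b m * c (d n m)) summable_on UNIV"
    by (rule summable_on_b_b[OF c]) (auto simp: d_def)
  have s2: "F2 summable_on UNIV"
    unfolding F2_def by (rule summable_on_b_b[OF c]) simp
  have ck: "norm (c k) \<le> M * (real (k + 1) * real (m + 1)) ^ J" for k m
  proof -
    have "M * real (k + 1) ^ J \<le> M * (real (k + 1) * real (m + 1)) ^ J"
      using M by (intro mult_left_mono power_mono) (auto simp: algebra_simps)
    then show ?thesis using c[of k] by linarith
  qed
  have s1: "F1 summable_on UNIV"
  proof (rule summable_on_maj2[of _ "r * M" "Suc (Suc J)"])
    fix k m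
    have "norm (F1 (k, m)) \<le> real (m + 1) * (r * (real (k + m + 1) * norm q ^ (m + k))) *
       (M * (real (k + 1) * real (m + 1)) ^ J)"
      unfolding F1_def prod.case norm_mult using nb[of "m + k"] ck[of k m] r M
      by (intro mult_mono) (auto simp: add_ac)
    also have "\<dots> \<le> (real (k + 1) * real (m + 1)) * (r * ((real (k + 1) * real (m + 1)) * norm q ^ (m + k))) *
       (M * (real (k + 1) * real (m + 1)) ^ J)"
      using prod[of k m] r M by (intro mult_mono mult_right_mono) auto
    also have "\<dots> = r * M * (maj (Suc (Suc J)) k * maj (Suc (Suc J)) m)"
      by (simp add: maj_def power_mult_distrib power_add mult_ac)
    finally show "norm (F1 (k, m)) \<le> r * M * (maj (Suc (Suc J)) k * maj (Suc (Suc J)) m)" .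
  qed
  have sn: "(\<lambda>n. b n * (of_nat n ^ i * c n)) summable_on UNIV" for i
  proof (rule summable_on_maj[of _ "r * M" "Suc J + i"])
    fix n
    have "norm (b n * (of_nat n ^ i * c n)) \<le> (r * (real (n + 1) * norm q ^ n)) * (real (n + 1) ^ i * (M * real (n + 1) ^ J))"
      unfolding norm_mult norm_power using nb[of n] c[of n] r M
      by (intro mult_mono) (auto intro: power_mono)
    then show "norm (b n * (of_nat n ^ i * c n)) \<le> r * M * maj (Suc J + i) n"
      by (simp add: maj_def power_add mult_ac)
  qed
  have h1: "((\<lambda>k. (\<Sum>\<^sub>\<infinity>m. of_nat m * b (m + k)) * c k) has_sum infsum F1 UNIV) UNIV"
    using has_sum_iterated[OF s1] by (simp add: F1_def infsum_cmult_left')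
  have e1: "(\<Sum>\<^sub>\<infinity>n. b n * (\<Sum>k\<le>n. of_nat (n - k) * c k)) = infsum F1 UNIV"
  proof (rule infsumI)
    show "((\<lambda>n. b n * (\<Sum>k\<le>n. of_nat (n - k) * c k)) has_sum infsum F1 UNIV) UNIV"
      using has_sum_antidiagonal[OF s1] by (simp add: F1_def sum_distrib_left mult_ac)
  qed
  have h2: "((\<lambda>k. (\<Sum>n\<le>k. b n * b (k - n)) * c k) has_sum infsum F2 UNIV) UNIV"
    using has_sum_antidiagonal[OF s2] by (simp add: F2_def sum_distrib_right)
  have h3: "((\<lambda>k. (2 * (\<Sum>\<^sub>\<infinity>m. b m * b (m + k))) * c k) has_sum (\<Sum>\<^sub>\<infinity>(n, m). b n * b m * c (d n m))) UNIV"
  proof -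
    have "b n * b m * c (d n m) = b m * b n * c (d m n)" for n m
      by (auto simp: d_def)
    moreover have "b n * b n * c (d n n) = 0" for n
      by (simp add: d_def c0)
    ultimately have "((\<lambda>k. 2 * (\<Sum>\<^sub>\<infinity>m. b m * b (m + k) * c (d m (m + k)))) has_sum
        (\<Sum>\<^sub>\<infinity>(n, m). b n * b m * c (d n m))) UNIV"
      using s3 by (rule has_sum_distance)
    then show ?thesis
      by (simp only: d_def le_add1 if_True add_diff_cancel_left' infsum_cmult_left' mult.assoc[of 2])
  qed
  have hb: "((\<lambda>n. b n * c n) has_sum (\<Sum>\<^sub>\<infinity>n. b n * c n)) UNIV"
    using sn[of 0] by simp
  have hb2: "((\<lambda>n. b n * (of_nat n ^ 2 * c n)) has_sum (\<Sum>\<^sub>\<infinity>n. b n * (of_nat n ^ 2 * c n))) UNIV"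
    using sn[of 2] by simp
  let ?f = "\<lambda>k. b k * (of_nat k ^ 2 * c k) - 12 * ((\<Sum>\<^sub>\<infinity>m. of_nat m * b (m + k)) * c k) - b k * c k
    - 6 * ((\<Sum>n\<le>k. b n * b (k - n)) * c k + (2 * (\<Sum>\<^sub>\<infinity>m. b m * b (m + k))) * c k - 4 * S * (b k * c k))"
  have "(?f has_sum ((\<Sum>\<^sub>\<infinity>n. b n * (of_nat n ^ 2 * c n)) - 12 * infsum F1 UNIV - (\<Sum>\<^sub>\<infinity>n. b n * c n)
    - 6 * (infsum F2 UNIV + (\<Sum>\<^sub>\<infinity>(n, m). b n * b m * c (d n m)) - 4 * S * (\<Sum>\<^sub>\<infinity>n. b n * c n)))) UNIV"
    by (intro has_sum_diff has_sum_add has_sum_cmult_right h1 h2 h3 hb hb2)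
  moreover have "?f k = 0" for k
  proof (cases "k = 0")
    case False
    have "?f k = (of_nat k ^ 2 * b k - 12 * (\<Sum>\<^sub>\<infinity>m. of_nat m * b (m + k)) - b k
    - 6 * ((\<Sum>n\<le>k. b n * b (k - n)) + 2 * (\<Sum>\<^sub>\<infinity>m. b m * b (m + k)) - 4 * S * b k)) * c k"
      by (simp add: algebra_simps)
    then show ?thesis
      using ramanujan_coefficient[of k] False by (simp add: S_def)
  qed (simp add: c0)
  ultimately show ?thesis
    unfolding e1 F2_def S_def d_def by (simp add: has_sum_0_simp has_sum_iff)
qed

end

section \<open>The differential equation of the Weierstrass function\<close>

text \<open>With $w = e^t$, this is $t^2 w / (1 - w)^2$.\<close>

definition wp_main :: "complex fps" where
  "wp_main = fps_exp 1 * bernoulli_fps ^ 2"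

text \<open>The Riccati equation of B = t / (e^t - 1), obtained by differentiating B (e^t - 1) =
  t.\<close>

lemma deriv_bernoulli_fps:
  "fps_X * fps_deriv bernoulli_fps = bernoulli_fps - fps_exp 1 * bernoulli_fps ^ 2"
proof -
  have "fps_deriv (bernoulli_fps * (fps_exp 1 - 1)) = 1"
    by (simp add: bernoulli_fps_mult)
  then have "fps_deriv bernoulli_fps * (fps_exp 1 - 1) + bernoulli_fps * fps_exp 1 = 1"
    by (simp add: algebra_simps)
  then have "fps_deriv bernoulli_fps * (fps_exp 1 - 1) = 1 - bernoulli_fps * fps_exp 1"
    by (simp add: algebra_simps)
  moreover have "fps_X * fps_deriv bernoulli_fps = bernoulli_fps * (fps_deriv bernoulli_fps * (fps_exp 1 - 1))"
    unfolding bernoulli_fps_mult[symmetric] by (simp add: mult_ac)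
  ultimately have "fps_X * fps_deriv bernoulli_fps = bernoulli_fps * (1 - bernoulli_fps * fps_exp 1)"
    by (simp only:)
  then show ?thesis
    by (simp only: right_diff_distrib power2_eq_square mult_ac mult_1_left)
qed

text \<open>w / (1 - w)^2 is minus the derivative of 1 / (e^t - 1), so \<open>wp_main\<close> is B -
  t B' with B = t / (e^t - 1).\<close>

lemma wp_main_nth: "wp_main $ n = (1 - of_nat n) * of_rat (bernoulli n) / fact n"
proof -
  have "wp_main = bernoulli_fps - fps_X * fps_deriv bernoulli_fps"
    by (simp add: deriv_bernoulli_fps wp_main_def)
  then have "wp_main $ n = bernoulli_fps $ n - (fps_X * fps_deriv bernoulli_fps) $ n"
    by (metis fps_sub_nth)
  also have "(fps_X * fps_deriv bernoulli_fps) $ n = of_nat n * bernoulli_fps $ n"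
    by (cases n) auto
  finally show ?thesis
    by (simp add: bernoulli_fps_def left_diff_distrib diff_divide_distrib)
qed

text \<open>For P = w / (1 - w)^2, \<open>V\<close> is t^3 P' and the left side is t^4 P'', so this
  is P'' = 6 P^2 + P with the pole at t = 0 cleared.\<close>

lemma wp_main_ode:
  defines "V \<equiv> fps_X * fps_deriv wp_main - 2 * wp_main"
  shows "fps_X * fps_deriv V - 3 * V = 6 * wp_main ^ 2 + wp_main * fps_X ^ 2"
proof -
  define E :: "complex fps" where "E = fps_exp 1"
  define B where "B = bernoulli_fps"
  have DE: "fps_deriv E = E" by (simp add: E_def)
  have DB: "fps_X * fps_deriv B = B - E * B ^ 2" and X: "fps_X = B * (E - 1)"
    by (simp_all add: B_def E_def deriv_bernoulli_fps bernoulli_fps_mult)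
  have A: "wp_main = E * B ^ 2" by (simp add: wp_main_def E_def B_def)
  have "fps_deriv (E * B ^ 2) = E * B ^ 2 + 2 * E * B * fps_deriv B"
    by (simp add: DE power2_eq_square algebra_simps)
  then have "V = fps_X * (E * B ^ 2) + 2 * E * B * (fps_X * fps_deriv B) - 2 * (E * B ^ 2)"
    by (simp add: V_def A algebra_simps)
  then have V: "V = - (B ^ 3 * E * (E + 1))"
    unfolding DB unfolding X by (simp add: algebra_simps power2_eq_square power3_eq_cube)
  have DV: "fps_deriv V = - (3 * B ^ 2 * fps_deriv B * E * (E + 1) + B ^ 3 * E * (2 * E + 1))"
    unfolding V by (simp add: DE power2_eq_square power3_eq_cube algebra_simps)
  have "fps_X * fps_deriv V = - (3 * B ^ 2 * (fps_X * fps_deriv B) * E * (E + 1) + fps_X * B ^ 3 * E * (2 * E + 1))"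
    unfolding DV by (simp add: algebra_simps)
  then show ?thesis
    unfolding DB A V unfolding X by algebra
qed

text \<open>The formal counterparts of $w^n + w^{-n}$ and of the Fejer kernel $(w^n + w^{-n} - 2) / (w + w^{-1} - 2)$.\<close>

definition cosh2_fps :: "nat \<Rightarrow> complex fps" where
  "cosh2_fps n = fps_exp (of_nat n) + fps_exp (- of_nat n)"

definition fejer_fps :: "nat \<Rightarrow> complex fps" where
  "fejer_fps n = of_nat n + (\<Sum>k=1..n. of_nat (n - k) * cosh2_fps k)"

lemma cosh2_fps_nth: "cosh2_fps n $ j = (of_nat n ^ j + (- of_nat n) ^ j) / fact j"
  by (simp add: cosh2_fps_def add_divide_distrib)

lemma cosh2_fps_0: "cosh2_fps 0 = 2"
  by (simp add: cosh2_fps_def)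

lemma cosh2_fps_mult:
  "cosh2_fps n * cosh2_fps m = cosh2_fps (n + m) + cosh2_fps (if n \<le> m then m - n else n - m)"
  by (auto simp: cosh2_fps_def algebra_simps of_nat_diff fps_exp_add_mult[symmetric])

lemma cosh2_fps_deriv2:
  "of_nat ((j + 1) * (j + 2)) * cosh2_fps n $ (j + 2) = of_nat n ^ 2 * cosh2_fps n $ j"
proof -
  have "fact (j + 2) = (of_nat ((j + 1) * (j + 2)) * fact j :: complex)"
    by (simp add: algebra_simps)
  moreover have "of_nat ((j + 1) * (j + 2)) \<noteq> (0 :: complex)"
    unfolding of_nat_eq_0_iff by simp
  moreover have "of_nat n ^ (j + 2) + (- of_nat n) ^ (j + 2) = of_nat n ^ 2 * (of_nat n ^ j + (- of_nat n) ^ j :: complex)"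
    by (simp add: power_add algebra_simps power2_eq_square)
  ultimately show ?thesis
    unfolding cosh2_fps_nth by (simp only: times_divide_eq_right mult_divide_mult_cancel_left_if if_False)
qed

lemma fejer_fps_Suc: "fejer_fps (Suc n) = fejer_fps n + 1 + (\<Sum>k=1..n. cosh2_fps k)"
proof -
  have "(\<Sum>k=1..Suc n. of_nat (Suc n - k) * cosh2_fps k) = (\<Sum>k=1..n. of_nat (n - k) * cosh2_fps k + cosh2_fps k)"
    by (simp, intro sum.cong) (auto simp: Suc_diff_le algebra_simps)
  then show ?thesis
    by (simp add: fejer_fps_def sum.distrib)
qed

lemma fejer_fps_mult: "(cosh2_fps 1 - 2) * fejer_fps n = cosh2_fps n - 2"
proof -
  \<comment> \<open>Two consecutive indices are carried because the recurrence for the kernel has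
    second order.\<close>
  have "(cosh2_fps 1 - 2) * fejer_fps n = cosh2_fps n - 2 \<and>
      (cosh2_fps 1 - 2) * fejer_fps (Suc n) = cosh2_fps (Suc n) - 2"
  proof (induction n)
    case 0
    then show ?case by (simp add: fejer_fps_def cosh2_fps_0)
  next
    case (Suc n)
    have "fejer_fps (Suc (Suc n)) = 2 * fejer_fps (Suc n) - fejer_fps n + cosh2_fps (Suc n)"
      by (simp add: fejer_fps_Suc)
    moreover have "cosh2_fps (Suc n) * cosh2_fps 1 = cosh2_fps (Suc (Suc n)) + cosh2_fps n"
      by (simp add: cosh2_fps_mult)
    ultimately show ?case using Suc by algebra
  qed
  then show ?thesis by blast
qed

text \<open>w + 1/w - 2 = (1 - w)^2 / w is the reciprocal of P = \<open>wp_main\<close> / t^2, so P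
  times w^n + w^(-n) - 2 is a finite cosine sum without a pole.\<close>

lemma wp_main_mult_cosh2: "wp_main * (cosh2_fps n - 2) = fps_X ^ 2 * fejer_fps n"
proof -
  have "fps_exp 1 * cosh2_fps 1 = fps_exp 1 ^ 2 + (1 :: complex fps)"
    by (simp add: cosh2_fps_def algebra_simps power2_eq_square fps_exp_add_mult[symmetric])
  moreover have "wp_main = fps_exp 1 * bernoulli_fps ^ 2" by (rule wp_main_def)
  ultimately show ?thesis
    using fejer_fps_mult[of n] bernoulli_fps_mult by algebra
qed

text \<open>The term k = 0 would change only the constant coefficient, \<open>cosh2_fps 0\<close>
  being 2; including it gives the inner sum of \<open>ramanujan_identity\<close>.\<close>

lemma fejer_fps_nth: "j > 0 \<Longrightarrow> fejer_fps n $ j = (\<Sum>k\<le>n. of_nat (n - k) * cosh2_fps k $ j)"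
proof -
  assume j: "j > 0"
  have "fejer_fps n $ j = (\<Sum>k=1..n. of_nat (n - k) * cosh2_fps k $ j)"
    using j by (simp add: fejer_fps_def fps_sum_nth fps_nth_of_nat fps_of_nat[symmetric])
  also have "\<dots> = (\<Sum>k\<le>n. of_nat (n - k) * cosh2_fps k $ j)"
    using j by (intro sum.mono_neutral_left) (auto simp: cosh2_fps_0 not_less_eq_eq fps_numeral_nth)
  finally show ?thesis .
qed

lemma norm_cosh2_fps_nth: "norm (cosh2_fps n $ j) \<le> 2 * real (n + 1) ^ j"
proof -
  have "norm (cosh2_fps n $ j) \<le> (real n ^ j + real n ^ j) / fact j"
    unfolding cosh2_fps_nth norm_divide
    by (intro divide_mono order_trans[OF norm_triangle_ineq]) (auto simp: norm_power)
  also have "\<dots> \<le> 2 * real n ^ j"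
    by (simp add: divide_le_eq mult_le_cancel_left1 fact_ge_1)
  also have "\<dots> \<le> 2 * real (n + 1) ^ j"
    by (intro mult_left_mono power_mono) auto
  finally show ?thesis .
qed

lemma infsum_sum_complex:
  fixes f :: "'i \<Rightarrow> 'a \<Rightarrow> complex"
  assumes "finite I" "\<And>i. i \<in> I \<Longrightarrow> f i summable_on UNIV"
  shows "(\<lambda>n. \<Sum>i\<in>I. f i n) summable_on UNIV \<and> (\<Sum>\<^sub>\<infinity>n. \<Sum>i\<in>I. f i n) = (\<Sum>i\<in>I. infsum (f i) UNIV)"
  using assms by (induction I rule: finite_induct) (auto simp: infsum_add summable_on_add)

context nome
begin

lemma norm_b_mult_le:
  assumes "\<And>n. norm (c n) \<le> M * real (n + 1) ^ J"
  shows "norm (b n * c n) \<le> M / (1 - norm q) * maj (Suc J) n"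
proof -
  have "M \<ge> 0" using order_trans[OF norm_ge_zero assms[of 0]] by simp
  then have "norm (b n * c n) \<le> (maj 1 n / (1 - norm q)) * (M * real (n + 1) ^ J)"
    unfolding norm_mult using norm_u_le_maj[of n 1] assms[of n] norm_q
    by (intro mult_mono) (auto simp: b_def maj_nonneg)
  then show ?thesis
    by (simp add: maj_def mult_ac)
qed

lemma summable_on_cosh2: "(\<lambda>n. b n * cosh2_fps n $ j) summable_on UNIV"
  by (rule summable_on_maj[OF norm_b_mult_le[OF norm_cosh2_fps_nth]])

text \<open>The sums of $b_n (w^n + w^{-n} - 2)$, of $b_n (w^n + w^{-n})$ and of $b_n$ times the Fejer kernel, taken coefficientwise.\<close>

definition tail_fps :: "complex fps" where
  "tail_fps = Abs_fps (\<lambda>j. \<Sum>\<^sub>\<infinity>n. b n * (cosh2_fps n - 2) $ j)"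

definition pert_fps :: "complex fps" where
  "pert_fps = Abs_fps (\<lambda>j. \<Sum>\<^sub>\<infinity>n. b n * cosh2_fps n $ j)"

definition mixed_fps :: "complex fps" where
  "mixed_fps = Abs_fps (\<lambda>j. \<Sum>\<^sub>\<infinity>n. b n * fejer_fps n $ j)"

lemma tail_fps_nth: "tail_fps $ j = (if j = 0 then 0 else pert_fps $ j)"
  by (auto simp: tail_fps_def pert_fps_def fps_numeral_nth cosh2_fps_nth)

lemma tail_fps_eq: "tail_fps = pert_fps - fps_const (2 * infsum b UNIV)"
proof (rule fps_ext)
  fix j
  show "tail_fps $ j = (pert_fps - fps_const (2 * infsum b UNIV)) $ j"
    unfolding tail_fps_nth
    by (auto simp: pert_fps_def cosh2_fps_nth infsum_cmult_left')
qed

text \<open>Each coefficient of the product is a finite combination of series over n, so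
  \<open>wp_main_mult_cosh2\<close> may be applied inside the sum.\<close>

lemma wp_main_mult_tail: "wp_main * tail_fps = fps_X ^ 2 * mixed_fps"
proof (rule fps_ext)
  fix j
  have s: "(\<lambda>n. b n * (cosh2_fps n - 2) $ i) summable_on UNIV" for i
    using summable_on_cosh2[of i] by (cases "i = 0") (auto simp: fps_numeral_nth cosh2_fps_nth)
  have "(wp_main * tail_fps) $ j = (\<Sum>i=0..j. \<Sum>\<^sub>\<infinity>n. wp_main $ i * (b n * (cosh2_fps n - 2) $ (j - i)))"
    by (simp add: fps_mult_nth tail_fps_def infsum_cmult_right')
  also have "\<dots> = (\<Sum>\<^sub>\<infinity>n. \<Sum>i=0..j. wp_main $ i * (b n * (cosh2_fps n - 2) $ (j - i)))"
    using infsum_sum_complex[of "{0..j}" "\<lambda>i n. wp_main $ i * (b n * (cosh2_fps n - 2) $ (j - i))"]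
      summable_on_cmult_right[OF s] by simp
  also have "\<dots> = (\<Sum>\<^sub>\<infinity>n. b n * (wp_main * (cosh2_fps n - 2)) $ j)"
    by (simp only: fps_mult_nth sum_distrib_left mult_ac)
  also have "\<dots> = (fps_X ^ 2 * mixed_fps) $ j"
    unfolding wp_main_mult_cosh2 by (simp add: fps_X_power_mult_nth mixed_fps_def)
  finally show "(wp_main * tail_fps) $ j = (fps_X ^ 2 * mixed_fps) $ j" .
qed

lemma infsum_mult_infsum:
  fixes f g :: "nat \<Rightarrow> complex"
  assumes "\<And>n. norm (f n) \<le> M * maj I n" "\<And>n. norm (g n) \<le> N * maj J n"
  shows "(\<lambda>(n, m). f n * g m) summable_on UNIV"
    and "(\<Sum>\<^sub>\<infinity>(n, m). f n * g m) = infsum f UNIV * infsum g UNIV"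
proof -
  have MN: "M \<ge> 0" "N \<ge> 0"
    using order_trans[OF norm_ge_zero assms(1)[of 0]] order_trans[OF norm_ge_zero assms(2)[of 0]]
    by (simp_all add: maj_def)
  show s: "(\<lambda>(n, m). f n * g m) summable_on UNIV"
  proof (rule summable_on_maj2[of _ "M * N" "max I J"])
    fix n m
    have "norm (f n) \<le> M * maj (max I J) n" "norm (g m) \<le> N * maj (max I J) m"
      using assms(1)[of n] assms(2)[of m] MN maj_mono[of I "max I J" n] maj_mono[of J "max I J" m]
      by (meson max.cobounded1 max.cobounded2 mult_left_mono order_trans)+
    then have "norm (f n * g m) \<le> (M * maj (max I J) n) * (N * maj (max I J) m)"
      unfolding norm_mult using MN by (intro mult_mono) (auto simp: maj_nonneg)
    then show "norm (case (n, m) of (n, m) \<Rightarrow> f n * g m) \<le> M * N * (maj (max I J) n * maj (max I J) m)"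
      by (simp add: mult_ac)
  qed
  show "(\<Sum>\<^sub>\<infinity>(n, m). f n * g m) = infsum f UNIV * infsum g UNIV"
    using infsumI[OF has_sum_iterated[OF s]] by (simp add: infsum_cmult_right' infsum_cmult_left')
qed

text \<open>The product-to-sum formula \<open>cosh2_fps_mult\<close> turns the square into the two
  double series of \<open>ramanujan_identity\<close>.\<close>

lemma pert_fps_square_nth:
  "(pert_fps ^ 2) $ j = (\<Sum>\<^sub>\<infinity>(n, m). b n * b m * cosh2_fps (n + m) $ j) +
     (\<Sum>\<^sub>\<infinity>(n, m). b n * b m * cosh2_fps (if n \<le> m then m - n else n - m) $ j)"
proof -
  define f where "f i n = b n * cosh2_fps n $ i" for i n
  have f: "norm (f i n) \<le> 2 / (1 - norm q) * maj (Suc i) n" for i n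
    unfolding f_def by (rule norm_b_mult_le[OF norm_cosh2_fps_nth])
  have s1: "(\<lambda>(n, m). b n * b m * cosh2_fps (n + m) $ j) summable_on UNIV"
    by (rule summable_on_b_b[OF norm_cosh2_fps_nth]) simp
  have s2: "(\<lambda>(n, m). b n * b m * cosh2_fps (if n \<le> m then m - n else n - m) $ j) summable_on UNIV"
    by (rule summable_on_b_b[OF norm_cosh2_fps_nth]) auto
  have "(pert_fps ^ 2) $ j = (\<Sum>i=0..j. infsum (f i) UNIV * infsum (f (j - i)) UNIV)"
    by (simp add: power2_eq_square fps_mult_nth pert_fps_def f_def[abs_def])
  also have "\<dots> = (\<Sum>i=0..j. \<Sum>\<^sub>\<infinity>(n, m). f i n * f (j - i) m)"
    by (simp only: infsum_mult_infsum(2)[OF f f])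
  also have "\<dots> = (\<Sum>\<^sub>\<infinity>x. \<Sum>i=0..j. case x of (n, m) \<Rightarrow> f i n * f (j - i) m)"
    using infsum_sum_complex[of "{0..j}" "\<lambda>i (n, m). f i n * f (j - i) m"] infsum_mult_infsum(1)[OF f f]
    by simp
  also have "\<dots> = (\<Sum>\<^sub>\<infinity>x. (case x of (n, m) \<Rightarrow> b n * b m * cosh2_fps (n + m) $ j) +
     (case x of (n, m) \<Rightarrow> b n * b m * cosh2_fps (if n \<le> m then m - n else n - m) $ j))"
  proof (rule infsum_cong, clarify)
    fix n m
    have "(\<Sum>i=0..j. f i n * f (j - i) m) = b n * b m * (cosh2_fps n * cosh2_fps m) $ j"
      unfolding f_def fps_mult_nth sum_distrib_left by (intro sum.cong) (simp_all add: mult_ac)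
    then show "(\<Sum>i=0..j. f i n * f (j - i) m) = b n * b m * cosh2_fps (n + m) $ j +
        b n * b m * cosh2_fps (if n \<le> m then m - n else n - m) $ j"
      by (simp add: cosh2_fps_mult algebra_simps)
  qed
  also have "\<dots> = (\<Sum>\<^sub>\<infinity>(n, m). b n * b m * cosh2_fps (n + m) $ j) +
     (\<Sum>\<^sub>\<infinity>(n, m). b n * b m * cosh2_fps (if n \<le> m then m - n else n - m) $ j)"
    by (rule infsum_add[OF s1 s2])
  finally show ?thesis .
qed

text \<open>With P = w / (1 - w)^2 and T = \<open>tail_fps\<close>, this is T'' - 12 P T - T - 6
  T^2, and it is \<open>ramanujan_identity\<close> for the coefficients c(n) of t^j in w^n + w^(-n).
  The second derivative supplies n^2, and T = \<open>pert_fps\<close> - 2S supplies the cross term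
  -4S. Since c(0) = 0 needs j > 0, an unknown constant survives.\<close>

lemma tail_fps_ode:
  assumes "j > 0"
  shows "(fps_deriv (fps_deriv tail_fps) - 12 * mixed_fps - tail_fps - 6 * tail_fps ^ 2) $ j = 0"
proof -
  define S where "S = infsum b UNIV"
  have c0: "cosh2_fps 0 $ j = 0"
    using assms by (simp add: cosh2_fps_0 fps_numeral_nth)
  have "fps_deriv (fps_deriv tail_fps) $ j = (\<Sum>\<^sub>\<infinity>n. b n * (of_nat n ^ 2 * cosh2_fps n $ j))"
  proof -
    have "fps_deriv (fps_deriv tail_fps) $ j = of_nat ((j + 1) * (j + 2)) * pert_fps $ (j + 2)"
      by (simp add: tail_fps_nth algebra_simps)
    also have "\<dots> = (\<Sum>\<^sub>\<infinity>n. b n * (of_nat ((j + 1) * (j + 2)) * cosh2_fps n $ (j + 2)))"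
      unfolding pert_fps_def fps_nth_Abs_fps infsum_cmult_right'[symmetric] by (simp only: mult_ac)
    finally show ?thesis
      by (simp only: cosh2_fps_deriv2)
  qed
  moreover have "mixed_fps $ j = (\<Sum>\<^sub>\<infinity>n. b n * (\<Sum>k\<le>n. of_nat (n - k) * cosh2_fps k $ j))"
    using assms by (simp add: mixed_fps_def fejer_fps_nth)
  moreover have "tail_fps $ j = (\<Sum>\<^sub>\<infinity>n. b n * cosh2_fps n $ j)"
    using assms by (simp add: tail_fps_nth pert_fps_def)
  moreover have "(tail_fps ^ 2) $ j = (pert_fps ^ 2) $ j - 4 * S * (\<Sum>\<^sub>\<infinity>n. b n * cosh2_fps n $ j)"
  proof -
    have "tail_fps ^ 2 = pert_fps ^ 2 - fps_const (4 * S) * pert_fps + fps_const (4 * S ^ 2)"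
      by (simp add: tail_fps_eq S_def power2_eq_square algebra_simps)
    then show ?thesis
      using assms by (simp add: pert_fps_def)
  qed
  ultimately show ?thesis
    using ramanujan_identity[OF c0 norm_cosh2_fps_nth]
    by (simp add: pert_fps_square_nth S_def numeral_fps_const)
qed

text \<open>This is $t^2 wp(t)$.\<close>

definition wp_fps :: "complex fps" where
  "wp_fps = wp_main + fps_const (1/12) * fps_X ^ 2 + fps_X ^ 2 * tail_fps"

text \<open>Says that wp'' - 6 wp^2 is constant. The shift 1/12 completes the square, 6 P^2 + P = 6
  (P + 1/12)^2 - 1/24, so the linear terms in P and in \<open>tail_fps\<close> cancel.\<close>

lemma wp_fps_ode:
  defines "V \<equiv> fps_X * fps_deriv wp_fps - 2 * wp_fps"
  shows "\<exists>K. fps_X * fps_deriv V - 3 * V - 6 * wp_fps ^ 2 = fps_const K * fps_X ^ 4"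
proof -
  define R where "R = fps_deriv (fps_deriv tail_fps) - 12 * mixed_fps - tail_fps - 6 * tail_fps ^ 2"
  have R: "R = fps_const (R $ 0)"
    using tail_fps_ode by (auto simp: fps_eq_iff R_def)
  define a :: "complex fps" where "a = fps_const (1/12)"
  have a: "12 * a = 1"
    by (simp add: a_def numeral_fps_const flip: fps_const_1_eq_1)
  have Da: "fps_deriv a = 0" by (simp add: a_def)
  define W where "W = fps_X * fps_deriv wp_main - 2 * wp_main"
  have W: "fps_X * fps_deriv W - 3 * W = 6 * wp_main ^ 2 + wp_main * fps_X ^ 2"
    unfolding W_def by (rule wp_main_ode)
  have V: "V = W + fps_X ^ 3 * fps_deriv tail_fps"
    unfolding V_def W_def wp_fps_def a_def[symmetric]
    by (simp add: Da power2_eq_square power3_eq_cube algebra_simps)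
  have "fps_X * fps_deriv V - 3 * V - 6 * wp_fps ^ 2 =
      fps_X * fps_deriv W - 3 * W + fps_X ^ 4 * fps_deriv (fps_deriv tail_fps) - 6 * wp_fps ^ 2"
    unfolding V by (simp add: power3_eq_cube eval_nat_numeral algebra_simps)
  also have "\<dots> = (R - 6 * a ^ 2) * fps_X ^ 4"
    unfolding W wp_fps_def a_def[symmetric] R_def
    using a wp_main_mult_tail by algebra
  also have "R - 6 * a ^ 2 = fps_const (R $ 0 - 6 * (1/12)^2)"
    by (subst R) (simp add: a_def numeral_fps_const power2_eq_square)
  finally show ?thesis by blast
qed

text \<open>The Euler operator t d/dt multiplies the coefficient of t^j by j, and the unknown
  constant is visible only at j = 4.\<close>

lemma wp_fps_recurrence:
  assumes "j \<noteq> 4"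
  shows "(of_nat j - 3) * (of_nat j - 2) * wp_fps $ j = 6 * (\<Sum>i\<le>j. wp_fps $ i * wp_fps $ (j - i))"
proof -
  obtain K where K: "fps_X * fps_deriv (fps_X * fps_deriv wp_fps - 2 * wp_fps)
     - 3 * (fps_X * fps_deriv wp_fps - 2 * wp_fps) - 6 * wp_fps ^ 2 = fps_const K * fps_X ^ 4"
    using wp_fps_ode by blast
  have th: "(fps_X * fps_deriv F) $ j = of_nat j * F $ j" for F :: "complex fps"
    by (cases j) auto
  have "(fps_X * fps_deriv (fps_X * fps_deriv wp_fps - 2 * wp_fps)
     - 3 * (fps_X * fps_deriv wp_fps - 2 * wp_fps) - 6 * wp_fps ^ 2) $ j = 0"
    unfolding K using assms by (simp add: fps_X_power_nth)
  then have "of_nat j * (of_nat j * wp_fps $ j - 2 * wp_fps $ j) - 3 * (of_nat j * wp_fps $ j - 2 * wp_fps $ j)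
      - 6 * (wp_fps ^ 2) $ j = 0"
    by (simp only: th fps_sub_nth numeral_fps_const fps_mult_left_const_nth)
  then show ?thesis
    by (simp add: power2_eq_square fps_mult_nth atLeast0AtMost algebra_simps)
qed

section \<open>The coefficients of wp as q-expansions\<close>

text \<open>Expand each u_m as a geometric series in q^m and group the pairs (m, d) by their
  product; the successors keep m, d and the product positive.\<close>

lemma lambert_series:
  "((\<lambda>n. of_nat (divisor_sigma j (Suc n)) * q ^ Suc n) has_sum (\<Sum>\<^sub>\<infinity>m. of_nat m ^ j * u m)) UNIV"
proof -
  let ?F = "\<lambda>(m, d). of_nat (Suc m) ^ j * q ^ (Suc m * Suc d)"
  let ?A = "SIGMA n:(UNIV :: nat set). {d. d dvd Suc n}"
  have s: "?F summable_on UNIV"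
  proof (rule summable_on_maj2[of _ 1 j])
    fix m d
    have "norm q ^ (Suc m * Suc d) \<le> norm q ^ (m + d)"
      using norm_q by (intro power_decreasing) auto
    moreover have "real (Suc m) ^ j * 1 \<le> real (m + 1) ^ j * real (d + 1) ^ j"
      by (intro mult_mono one_le_power) auto
    ultimately have "real (Suc m) ^ j * 1 * norm q ^ (Suc m * Suc d) \<le>
        (real (m + 1) ^ j * real (d + 1) ^ j) * norm q ^ (m + d)"
      by (intro mult_mono) auto
    moreover have "norm (?F (m, d)) = real (Suc m) ^ j * 1 * norm q ^ (Suc m * Suc d)"
      by (simp only: prod.case norm_mult norm_power norm_of_nat mult_1_right)
    ultimately show "norm (?F (m, d)) \<le> 1 * (maj j m * maj j d)"
      by (simp only: maj_def power_add mult_ac mult_1_left)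
  qed
  have geo: "(\<Sum>\<^sub>\<infinity>d. q ^ (m * Suc d)) = u m" if "m > 0" for m
  proof -
    have nq: "norm (q ^ m) < 1"
      using norm_q that by (simp add: norm_power power_less_one_iff)
    have "((\<lambda>d. (q ^ m) ^ d) has_sum (1 / (1 - q ^ m))) UNIV"
      using geometric_sums[OF nq] summable_geometric[of "norm (q ^ m)"] nq
      by (intro norm_summable_imp_has_sum) (auto simp: norm_power)
    then have "((\<lambda>d. q ^ m * (q ^ m) ^ d) has_sum (q ^ m * (1 / (1 - q ^ m)))) UNIV"
      by (rule has_sum_cmult_right)
    moreover have "q ^ m * (q ^ m) ^ d = q ^ (m * Suc d)" for d
      by (simp add: power_add power_mult)
    ultimately show ?thesis
      by (intro infsumI) (simp add: u_def)
  qed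
  have "infsum ?F UNIV = (\<Sum>\<^sub>\<infinity>m. of_nat (Suc m) ^ j * u (Suc m))"
    using infsumI[OF has_sum_iterated[OF s]] by (simp add: infsum_cmult_right' geo del: mult_Suc mult_Suc_right of_nat_Suc)
  also have "\<dots> = (\<Sum>\<^sub>\<infinity>m\<in>{0<..}. of_nat m ^ j * u m)"
    by (rule infsum_reindex_bij_witness[of _ "\<lambda>m. m - 1" Suc]) auto
  also have "\<dots> = (\<Sum>\<^sub>\<infinity>m. of_nat m ^ j * u m)"
    by (rule infsum_cong_neutral) (auto simp: u_0)
  finally have F: "(?F has_sum (\<Sum>\<^sub>\<infinity>m. of_nat m ^ j * u m)) UNIV"
    using s by (simp add: has_sum_iff)
  have div: "Suc (a + (b + a * b)) div Suc a = Suc b" "Suc a dvd Suc (a + (b + a * b))" for a b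
    using nonzero_mult_div_cancel_left[of "Suc a" "Suc b"] dvd_triv_left[of "Suc a" "Suc b"] by simp_all
  have "(?F has_sum (\<Sum>\<^sub>\<infinity>m. of_nat m ^ j * u m)) UNIV \<longleftrightarrow> ((\<lambda>(n, d). of_nat d ^ j * q ^ Suc n) has_sum (\<Sum>\<^sub>\<infinity>m. of_nat m ^ j * u m)) ?A"
  proof (rule has_sum_reindex_bij_witness[of _ "\<lambda>(n, d). (d - 1, Suc n div d - 1)" "\<lambda>(m, d). (Suc m * Suc d - 1, Suc m)"])
    fix x assume "x \<in> ?A"
    then obtain n d where x: "x = (n, d)" "d dvd Suc n" by auto
    then have "Suc (d - 1) = d" "Suc (Suc n div d - 1) = Suc n div d"
      by (auto simp: dvd_div_eq_0_iff intro!: Suc_pred Nat.gr0I simp del: Suc_diff_1)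
    moreover from this x have "Suc (d - 1) * Suc (Suc n div d - 1) - 1 = n"
      by (simp only: dvd_mult_div_cancel diff_Suc_1)
    ultimately show "(case (case x of (n, d) \<Rightarrow> (d - 1, Suc n div d - 1)) of (m, d) \<Rightarrow> (Suc m * Suc d - 1, Suc m)) = x"
      using x by (simp only: prod.case)
  qed (auto simp: div simp del: of_nat_Suc)
  with F have h: "((\<lambda>(n, d). of_nat d ^ j * q ^ Suc n) has_sum (\<Sum>\<^sub>\<infinity>m. of_nat m ^ j * u m)) ?A"
    by blast
  have sA: "(\<lambda>(n, d). of_nat d ^ j * q ^ Suc n) summable_on ?A"
    using h by (rule has_sum_imp_summable)
  have "((\<lambda>n. \<Sum>\<^sub>\<infinity>d\<in>{d. d dvd Suc n}. of_nat d ^ j * q ^ Suc n) has_sum (\<Sum>\<^sub>\<infinity>m. of_nat m ^ j * u m)) UNIV"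
    using infsum_Sigma'_banach[OF sA] summable_on_Sigma_banach[OF sA] infsumI[OF h]
    by (simp add: has_sum_iff)
  then show ?thesis
    by (simp add: divisor_sigma_def sum_distrib_right infsum_finite finite_divisors_nat)
qed

lemma wp_fps_nth_odd: "odd j \<Longrightarrow> wp_fps $ j = 0"
proof -
  assume j: "odd j"
  \<comment> \<open>B_1 is nonzero, but at j = 1 the factor 1 - j in \<open>wp_main_nth\<close>
    vanishes.\<close>
  have "wp_main $ j = 0"
    using bernoulli_odd[of j] j by (cases "j = 1") (auto simp: wp_main_nth odd_pos elim: oddE)
  moreover have "(fps_X ^ 2 * tail_fps) $ j = 0"
    using j by (auto simp: fps_X_power_mult_nth tail_fps_nth pert_fps_def cosh2_fps_nth)
  ultimately show ?thesis
    using j by (auto simp: wp_fps_def fps_X_power_nth)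
qed

lemma wp_fps_nth_0: "wp_fps $ 0 = 1"
  by (simp add: wp_fps_def wp_main_nth bernoulli_0)

text \<open>The shift 1/12 also cancels the coefficient -B_2 / 2 of \<open>wp_main\<close>, so wp
  has no constant term.\<close>

lemma wp_fps_nth_2: "wp_fps $ 2 = 0"
proof -
  have "bernoulli 2 = 1 / 6"
    by (simp add: bernoulli_def eval_nat_numeral Let_def)
  then have "of_rat (bernoulli 2) = (1 / 6 :: complex)"
    by (simp only:) (simp add: of_rat_divide)
  then show ?thesis
    by (simp add: wp_fps_def wp_main_nth fps_X_power_mult_nth tail_fps_nth fact_2 of_rat_divide)
qed

text \<open>The last factor is E_k as a series in q. The coefficient k - 2 of
  \<open>tail_fps\<close> enters; its n^(k-2) and the n in \<open>b\<close> combine to the n^(k-1)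
  of \<open>lambert_series\<close>.\<close>

lemma wp_fps_nth_even:
  assumes "even k" "k \<ge> 4"
  shows "wp_fps $ k = - (of_nat k - 1) * of_rat (bernoulli k) / fact k *
     (1 - of_rat (2 * of_nat k / bernoulli k) * (\<Sum>n. of_nat (divisor_sigma (k - 1) (Suc n)) * q ^ Suc n))"
proof -
  define S where "S = (\<Sum>\<^sub>\<infinity>m. of_nat m ^ (k - 1) * u m)"
  have S: "S = (\<Sum>n. of_nat (divisor_sigma (k - 1) (Suc n)) * q ^ Suc n)"
    unfolding S_def using has_sum_imp_sums[OF lambert_series] by (rule sums_unique)
  define m where "m = k - 2"
  have m: "k = Suc (Suc m)" "even m" "m > 0"
    using assms by (auto simp: m_def)
  have "tail_fps $ m = (\<Sum>\<^sub>\<infinity>n. 2 / fact m * (of_nat n ^ (k - 1) * u n))"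
    using m by (auto simp: tail_fps_nth pert_fps_def cosh2_fps_nth b_def intro!: infsum_cong)
  then have t: "tail_fps $ m = 2 / fact m * S"
    by (simp only: infsum_cmult_right' S_def)
  have "wp_fps $ k = (1 - of_nat k) * of_rat (bernoulli k) / fact k + 2 / fact m * S"
    using m t by (simp add: wp_fps_def wp_main_nth fps_X_power_mult_nth fps_X_power_nth)
  also have "2 / fact m * S = (of_nat k - 1) * (2 * of_nat k) / fact k * S"
  proof -
    have "of_nat (k * (k - 1)) \<noteq> (0 :: complex)"
      unfolding of_nat_eq_0_iff using m by simp
    moreover have "fact k = of_nat (k * (k - 1)) * (fact m :: complex)"
      using m by (simp add: algebra_simps)
    moreover have "(of_nat k - 1) * (2 * of_nat k) = of_nat (k * (k - 1)) * (2 :: complex)"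
      using m by (simp add: algebra_simps)
    ultimately show ?thesis
      by (simp only: mult_divide_mult_cancel_left_if if_False)
  qed
  also have "(1 - of_nat k) * of_rat (bernoulli k) / fact k + (of_nat k - 1) * (2 * of_nat k) / fact k * S =
      - (of_nat k - 1) * of_rat (bernoulli k) / fact k * (1 - of_rat (2 * of_nat k / bernoulli k) * S)"
  proof -
    have "of_rat (bernoulli k) * (1 - of_rat (2 * of_nat k / bernoulli k) * S) = of_rat (bernoulli k) - 2 * of_nat k * S"
      using bernoulli_even_nonzero[OF assms(1)] by (simp add: of_rat_divide of_rat_mult field_simps)
    then have "- (of_nat k - 1) / fact k * (of_rat (bernoulli k) * (1 - of_rat (2 * of_nat k / bernoulli k) * S)) =
      - (of_nat k - 1) / fact k * (of_rat (bernoulli k) - 2 * of_nat k * S)"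
      by (simp only:)
    then show ?thesis
      by (simp add: algebra_simps diff_divide_distrib add_divide_distrib)
  qed
  finally show ?thesis
    by (simp only: S)
qed

end

section \<open>Rational coefficients with odd denominators\<close>

text \<open>Membership in the localization of the integers at 2. Fractions need not be reduced, so
  closure under ring operations is immediate.\<close>

definition odd_denom :: "rat \<Rightarrow> bool" where
  "odd_denom r \<longleftrightarrow> (\<exists>m d. odd d \<and> r = of_int m / of_int d)"

lemma odd_denom_add:
  assumes "odd_denom r" "odd_denom s"
  shows "odd_denom (r + s)"
proof -
  obtain m d m' d' where "odd d" "odd d'" "r = of_int m / of_int d" "s = of_int m' / of_int d'"
    using assms by (auto simp: odd_denom_def)
  moreover from this have "d \<noteq> 0" "d' \<noteq> 0" by auto
  ultimately have "r + s = of_int (m * d' + m' * d) / of_int (d * d')" "odd (d * d')"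
    by (simp_all add: add_frac_eq)
  then show ?thesis unfolding odd_denom_def by blast
qed

lemma odd_denom_mult:
  assumes "odd_denom r" "odd_denom s"
  shows "odd_denom (r * s)"
proof -
  obtain m d m' d' where "odd d" "odd d'" "r = of_int m / of_int d" "s = of_int m' / of_int d'"
    using assms by (auto simp: odd_denom_def)
  then have "r * s = of_int (m * m') / of_int (d * d')" "odd (d * d')"
    by simp_all
  then show ?thesis unfolding odd_denom_def by blast
qed

lemma odd_denom_of_int: "odd_denom (of_int m)"
  unfolding odd_denom_def by (rule exI[of _ m], rule exI[of _ 1]) simp

lemma odd_denom_simps: "odd_denom (numeral m)" "odd_denom (- numeral m)" "odd_denom 1" "odd_denom 0" "odd_denom (of_nat n)"
  using odd_denom_of_int[of "numeral m"] odd_denom_of_int[of "- numeral m"] odd_denom_of_int[of 1]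
    odd_denom_of_int[of 0] odd_denom_of_int[of "int n"] by simp_all

lemma odd_denom_inverse: "odd n \<Longrightarrow> odd_denom (1 / of_nat n)"
  unfolding odd_denom_def by (rule exI[of _ 1], rule exI[of _ "int n"]) simp

text \<open>An odd denominator stays odd in lowest terms, so only the multiplicity of the numerator
  remains.\<close>

lemma padic_val_rat_2_nonneg:
  assumes "odd_denom r" "r \<noteq> 0"
  shows "padic_val_rat 2 r \<ge> 0"
proof -
  obtain m d where md: "odd d" "r = of_int m / of_int d"
    using assms by (auto simp: odd_denom_def)
  obtain n e where q: "quotient_of r = (n, e)" by fastforce
  have e: "e > 0" "coprime n e" "r = of_int n / of_int e"
    using quotient_of_denom_pos[OF q] quotient_of_coprime[OF q] quotient_of_div[OF q] by auto
  have "of_int (n * d) = (of_int (m * e) :: rat)"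
    using md e by (auto simp: field_simps)
  then have "n * d = m * e" by (simp only: of_int_eq_iff)
  have "odd e"
  proof
    assume "even e"
    then have "even (n * d)" using \<open>n * d = m * e\<close> by simp
    with md have "even n" by simp
    with \<open>even e\<close> e(2) show False by auto
  qed
  then have "multiplicity 2 e = 0"
    by (simp add: not_dvd_imp_multiplicity_0)
  then show ?thesis
    by (simp add: padic_val_rat_def q)
qed

text \<open>Functions that are polynomials in $x$ (of weight 4) and $y$ (of weight 6), homogeneous of weight $k$, with 2-integral coefficients.\<close>

inductive weighted_form :: "('a \<Rightarrow> complex) \<Rightarrow> ('a \<Rightarrow> complex) \<Rightarrow> nat \<Rightarrow> ('a \<Rightarrow> complex) \<Rightarrow> bool"
  for x y k where
  zero: "weighted_form x y k (\<lambda>s. 0)"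
| add_monom: "weighted_form x y k f \<Longrightarrow> odd_denom r \<Longrightarrow> 4 * a + 6 * b = k \<Longrightarrow>
    weighted_form x y k (\<lambda>s. of_rat r * x s ^ a * y s ^ b + f s)"

lemma weighted_form_add: "weighted_form x y k f \<Longrightarrow> weighted_form x y k g \<Longrightarrow> weighted_form x y k (\<lambda>s. f s + g s)"
proof (induction rule: weighted_form.induct)
  case (add_monom f r a b)
  then show ?case
    using weighted_form.add_monom[of x y k "\<lambda>s. f s + g s" r a b] by (simp add: add.assoc)
qed simp

lemma weighted_form_monom_mult:
  assumes "weighted_form x y k f" "odd_denom r" "4 * a + 6 * b = l"
  shows "weighted_form x y (k + l) (\<lambda>s. of_rat r * x s ^ a * y s ^ b * f s)"
  using assms(1)
proof (induction rule: weighted_form.induct)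
  case zero
  then show ?case using weighted_form.zero by simp
next
  case (add_monom f r' a' b')
  have "weighted_form x y (k + l) (\<lambda>s. of_rat (r * r') * x s ^ (a + a') * y s ^ (b + b') + of_rat r * x s ^ a * y s ^ b * f s)"
    using add_monom assms by (intro weighted_form.add_monom odd_denom_mult) auto
  then show ?case
    by (simp add: of_rat_mult power_add algebra_simps)
qed

lemma weighted_form_mult:
  assumes "weighted_form x y k f" "weighted_form x y l g"
  shows "weighted_form x y (k + l) (\<lambda>s. f s * g s)"
  using assms(1)
proof (induction rule: weighted_form.induct)
  case zero
  then show ?case using weighted_form.zero by simp
next
  case (add_monom f r a b)
  have "weighted_form x y (k + l) (\<lambda>s. of_rat r * x s ^ a * y s ^ b * g s + f s * g s)"
    using weighted_form_monom_mult[OF assms(2) add_monom(2,3)] add_monom(4)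
    by (intro weighted_form_add) (simp_all add: add.commute)
  then show ?case
    by (simp add: algebra_simps)
qed

lemma weighted_form_scale: "weighted_form x y k f \<Longrightarrow> odd_denom r \<Longrightarrow> weighted_form x y k (\<lambda>s. of_rat r * f s)"
  using weighted_form_monom_mult[of x y k f r 0 0 0] by simp

lemma weighted_form_sum:
  assumes "finite I" "\<And>i. i \<in> I \<Longrightarrow> weighted_form x y k (f i)"
  shows "weighted_form x y k (\<lambda>s. \<Sum>i\<in>I. f i s)"
  using assms by (induction I rule: finite_induct) (auto intro: weighted_form.zero weighted_form_add)

text \<open>Vanishing constant terms remove i = 0 and i = n, so the value at n uses only strictly
  lower weights, as strong induction requires.\<close>

lemma weighted_form_convolution:
  assumes "\<And>i. i < n \<Longrightarrow> weighted_form x y (2 * i) (f i)" "\<And>i. i < n \<Longrightarrow> weighted_form x y (2 * i) (g i)"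
    and "f 0 = (\<lambda>s. 0)" "g 0 = (\<lambda>s. 0)"
  shows "weighted_form x y (2 * n) (\<lambda>s. \<Sum>i=0..n. f i s * g (n - i) s)"
proof (rule weighted_form_sum)
  fix i assume i: "i \<in> {0..n}"
  show "weighted_form x y (2 * n) (\<lambda>s. f i s * g (n - i) s)"
  proof (cases "i = 0 \<or> i = n")
    case True
    then show ?thesis using assms weighted_form.zero by auto
  next
    case False
    then have "weighted_form x y (2 * i + 2 * (n - i)) (\<lambda>s. f i s * g (n - i) s)"
      using i assms by (intro weighted_form_mult) auto
    moreover have "2 * i + 2 * (n - i) = 2 * n" using i by auto
    ultimately show ?thesis by simp
  qed
qed simp

lemma finite_exps_46: "finite (exps_46 k)"
  by (rule finite_subset[of _ "{..k}"]) (auto simp: exps_46_def)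

lemma weighted_form_expand:
  assumes "weighted_form x y k f"
  shows "\<exists>w. (\<forall>a. odd_denom (w a)) \<and>
    (\<forall>s. f s = (\<Sum>a\<in>exps_46 k. of_rat (w a) * x s ^ a * y s ^ ((k - 4 * a) div 6)))"
  using assms
proof (induction rule: weighted_form.induct)
  case zero
  show ?case by (rule exI[of _ "\<lambda>_. 0"]) (simp add: odd_denom_simps)
next
  case (add_monom f r a b)
  then obtain w where w: "\<And>a. odd_denom (w a)"
    "\<And>s. f s = (\<Sum>a\<in>exps_46 k. of_rat (w a) * x s ^ a * y s ^ ((k - 4 * a) div 6))"
    by blast
  have a: "a \<in> exps_46 k" "(k - 4 * a) div 6 = b"
    using add_monom.hyps by (auto simp: exps_46_def)
  show ?case
  proof (intro exI[of _ "w(a := r + w a)"] conjI allI)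
    fix a' show "odd_denom ((w(a := r + w a)) a')"
      using w add_monom.hyps by (auto intro: odd_denom_add)
  next
    fix s
    have "(\<Sum>a'\<in>exps_46 k. of_rat ((w(a := r + w a)) a') * x s ^ a' * y s ^ ((k - 4 * a') div 6)) =
      (\<Sum>a'\<in>exps_46 k. (if a' = a then of_rat r * x s ^ a * y s ^ b else 0)
         + of_rat (w a') * x s ^ a' * y s ^ ((k - 4 * a') div 6))"
      using a by (intro sum.cong) (auto simp: of_rat_add algebra_simps)
    also have "\<dots> = of_rat r * x s ^ a * y s ^ b + f s"
      using a finite_exps_46 by (simp add: sum.distrib w)
    finally show "of_rat r * x s ^ a * y s ^ b + f s =
      (\<Sum>a'\<in>exps_46 k. of_rat ((w(a := r + w a)) a') * x s ^ a' * y s ^ ((k - 4 * a') div 6))" ..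
  qed
qed

section \<open>The cubic equation and 2-integrality by induction\<close>

text \<open>The series variable stands for t^2: \<open>U\<close> is t^2 wp, \<open>W\<close> is t^3
  wp' / 2, and \<open>u\<close>, \<open>v\<close> are these without their constant terms 1 and -1.
  Splitting these off isolates the part linear in c(n).\<close>

lemma cubic_of_recurrence:
  fixes c :: "nat \<Rightarrow> complex"
  assumes c0: "c 0 = 1" and c1: "c 1 = 0"
    and rec: "\<And>n. n \<noteq> 2 \<Longrightarrow> (2 * of_nat n - 3) * (2 * of_nat n - 2) * c n = 6 * (\<Sum>i\<le>n. c i * c (n - i))"
  defines "u \<equiv> Abs_fps c - 1" and "v \<equiv> Abs_fps (\<lambda>n. if n = 0 then 0 else (of_nat n - 1) * c n)"
  assumes n: "n \<ge> 4"
  shows "of_nat (2 * n + 1) * c n = (v ^ 2) $ n - 3 * (u ^ 2) $ n - (u ^ 2 * u) $ n + 5 * c 2 * c (n - 2)"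
proof -
  define U where "U = Abs_fps c"
  define d where "d f = fps_X * fps_deriv f" for f :: "complex fps"
  have d_nth: "d f $ n = of_nat n * f $ n" for f n
    by (cases n) (simp_all add: d_def)
  have d_mult: "d (f * g) = d f * g + f * d g" and d_diff: "d (f - g) = d f - d g"
    and d_add: "d (f + g) = d f + d g" for f g
    by (simp_all add: d_def algebra_simps)
  have d_const: "d (fps_const a) = 0" for a by (simp add: d_def)
  have dX: "d fps_X = fps_X" by (simp add: d_def)
  define W where "W = d U - U"
  \<comment> \<open>The defect of the recurrence at the excluded index n = 2, so that the
    differential equation holds in every degree.\<close>
  define \<kappa> where "\<kappa> = (2 * c 2 - 6 * (U ^ 2) $ 2) / 4"
  define a where "a = fps_const (2 * \<kappa>)"
  have U2: "(U ^ 2) $ n = (\<Sum>i\<le>n. c i * c (n - i))" for n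
    by (simp add: power2_eq_square fps_mult_nth U_def atLeast0AtMost)
  have "2 * d W = 3 * W + 3 * U ^ 2 + a * fps_X ^ 2"
  proof (rule fps_ext)
    fix n
    have "2 * (of_nat n * (of_nat n * c n - c n)) = 3 * (of_nat n * c n - c n) + 3 * (U ^ 2) $ n + (if n = 2 then 2 * \<kappa> else 0)"
    proof (cases "n = 2")
      case True
      then show ?thesis by (simp add: \<kappa>_def field_simps)
    next
      case False
      have "2 * (2 * (of_nat n * (of_nat n * c n - c n)) - 3 * (of_nat n * c n - c n)) =
          (2 * of_nat n - 3) * (2 * of_nat n - 2) * c n"
        by (simp add: algebra_simps)
      also have "\<dots> = 2 * (3 * (U ^ 2) $ n)"
        using rec[OF False] by (simp add: U2)
      finally have "2 * (of_nat n * (of_nat n * c n - c n)) - 3 * (of_nat n * c n - c n) = 3 * (U ^ 2) $ n"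
        by (subst (asm) mult_left_cancel) auto
      then show ?thesis
        using False by (simp add: algebra_simps)
    qed
    then show "(2 * d W) $ n = (3 * W + 3 * U ^ 2 + a * fps_X ^ 2) $ n"
      by (simp add: W_def d_nth U_def a_def numeral_fps_const fps_X_power_nth)
  qed
  then have dW: "2 * d W = 3 * W + 3 * U ^ 2 + a * fps_X ^ 2" .
  have dU: "d U = W + U" by (simp add: W_def)
  define Z where "Z = W ^ 2 - U ^ 3 - a * fps_X ^ 2 * U"
  \<comment> \<open>The first integral of the second-order equation; it is homogeneous of degree 3 for the Euler operator.\<close>
  have "d Z = 3 * Z"
  proof -
    have "d Z = W * (2 * d W) - 3 * U ^ 2 * d U - (2 * a * fps_X ^ 2 * U + a * fps_X ^ 2 * d U)"
      by (simp add: Z_def power2_eq_square power3_eq_cube d_mult d_diff d_add a_def d_const dX algebra_simps)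
    then show ?thesis
      unfolding dW dU Z_def by (simp add: algebra_simps power2_eq_square power3_eq_cube)
  qed
  then have Z: "Z $ n = 0" if "n \<noteq> 3" for n
    using that d_nth[of Z n] by (auto simp: numeral_fps_const of_nat_eq_iff[of n 3, where 'a = complex, simplified])
  have Uu: "U = 1 + u" and Wv: "W = v - 1"
    by (simp_all add: U_def u_def W_def v_def fps_eq_iff d_nth c0 algebra_simps)
  \<comment> \<open>The constants of (v - 1)^2 and (1 + u)^3 cancel, and the linear part has
    coefficient 2 (n - 1) + 3 = 2n + 1 at c(n).\<close>
  have key: "2 * v + 3 * u = v ^ 2 - 3 * u ^ 2 - u ^ 2 * u - a * fps_X ^ 2 * U - Z"
    unfolding Z_def Wv Uu by (simp add: algebra_simps power2_eq_square power3_eq_cube)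
  have low: "u $ 0 = 0" "u $ Suc 0 = 0" "v $ 0 = 0" "v $ Suc 0 = 0"
    using c0 c1 by (simp_all add: u_def v_def)
  have sq: "(v ^ 2) $ 2 = 0" "(u ^ 2) $ 2 = 0" "(u ^ 2 * u) $ 2 = 0"
    by (simp_all add: power2_eq_square fps_mult_nth eval_nat_numeral low)
  have aU: "(a * fps_X ^ 2 * U) $ n = (if n < 2 then 0 else 2 * \<kappa> * c (n - 2))" for n
    by (simp add: a_def U_def mult.assoc fps_X_power_mult_nth)
  \<comment> \<open>Degree 2 determines \<open>\<kappa>\<close>: products of \<open>u\<close> and
    \<open>v\<close> start in degree 4 and \<open>Z\<close> lives in degree 3.\<close>
  have "2 * v $ 2 + 3 * u $ 2 = (v ^ 2) $ 2 - 3 * (u ^ 2) $ 2 - (u ^ 2 * u) $ 2 - (a * fps_X ^ 2 * U) $ 2 - Z $ 2"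
    using arg_cong[OF key, of "\<lambda>f. f $ 2"] by (simp add: numeral_fps_const)
  then have k: "2 * \<kappa> = - 5 * c 2"
    unfolding sq aU by (simp add: Z v_def u_def c0)
  have "2 * v $ n + 3 * u $ n = (v ^ 2) $ n - 3 * (u ^ 2) $ n - (u ^ 2 * u) $ n - (a * fps_X ^ 2 * U) $ n - Z $ n"
    using arg_cong[OF key, of "\<lambda>f. f $ n"] by (simp add: numeral_fps_const)
  then show ?thesis
    using n unfolding aU k by (simp add: Z v_def u_def algebra_simps)
qed

text \<open>c(2) / 3 and c(3) / 5 stand for G_4 and G_6. From n = 4 on,
  \<open>cubic_of_recurrence\<close> expresses c(n) by lower ones with integer coefficients and the
  odd divisor 2n + 1; the weights n - 1 in \<open>v\<close> are integers too.\<close>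

lemma weighted_form_of_recurrence:
  fixes c :: "nat \<Rightarrow> 'a \<Rightarrow> complex"
  assumes c0: "\<And>s. c 0 s = 1" and c1: "\<And>s. c 1 s = 0"
    and rec: "\<And>n s. n \<noteq> 2 \<Longrightarrow> (2 * of_nat n - 3) * (2 * of_nat n - 2) * c n s = 6 * (\<Sum>i\<le>n. c i s * c (n - i) s)"
  shows "weighted_form (\<lambda>s. c 2 s / 3) (\<lambda>s. c 3 s / 5) (2 * n) (c n)"
proof (induction n rule: less_induct)
  case (less n)
  let ?x = "\<lambda>s. c 2 s / 3" and ?y = "\<lambda>s. c 3 s / 5"
  consider "n = 0" | "n = 1" | "n = 2" | "n = 3" | "n \<ge> 4" by linarith
  then show ?case
  proof cases
    case 1
    then show ?thesis
      using weighted_form.add_monom[OF weighted_form.zero odd_denom_simps(3), of 0 0 0 ?x ?y] by (simp add: c0[abs_def])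
  next
    case 2
    then show ?thesis
      using weighted_form.zero[of ?x ?y 2] c1 by (simp add: fun_eq_iff[symmetric] c1[abs_def])
  next
    case 3
    then show ?thesis
      \<comment> \<open>The numeral is 3: c(2) is 3 times the first generator.\<close>
      using weighted_form.add_monom[OF weighted_form.zero odd_denom_simps(1)[of "num.Bit1 num.One"], of 1 0 4 ?x ?y] by simp
  next
    case 4
    then show ?thesis
      \<comment> \<open>The numeral is 5: c(3) is 5 times the second generator.\<close>
      using weighted_form.add_monom[OF weighted_form.zero odd_denom_simps(1)[of "num.Bit1 (num.Bit0 num.One)"], of 0 1 6 ?x ?y] by simp
  next
    case 5
    define u where "u s = Abs_fps (\<lambda>n. c n s) - 1" for s
    define v where "v s = Abs_fps (\<lambda>n. if n = 0 then 0 else (of_nat n - 1) * c n s)" for s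
    have u: "weighted_form ?x ?y (2 * i) (\<lambda>s. u s $ i)" if "i < n" for i
      using less[OF that] weighted_form.zero by (cases "i = 0") (simp_all add: u_def c0)
    have v: "weighted_form ?x ?y (2 * i) (\<lambda>s. v s $ i)" if "i < n" for i
    proof (cases "i = 0")
      case False
      then show ?thesis
        using weighted_form_scale[OF less[OF that] odd_denom_simps(5)[of "i - 1"]]
        by (simp add: v_def of_nat_diff of_rat_diff)
    qed (simp add: v_def weighted_form.zero)
    have zero: "(\<lambda>s. u s $ 0) = (\<lambda>s. 0)" "(\<lambda>s. v s $ 0) = (\<lambda>s. 0)"
      by (simp_all add: u_def v_def c0)
    have u2: "weighted_form ?x ?y (2 * i) (\<lambda>s. (u s ^ 2) $ i)" if "i \<le> n" for i
      unfolding power2_eq_square fps_mult_nth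
      by (rule weighted_form_convolution) (use that u zero in auto)
    have u3: "weighted_form ?x ?y (2 * n) (\<lambda>s. (u s ^ 2 * u s) $ n)"
      unfolding fps_mult_nth[of "_ ^ 2"]
      by (rule weighted_form_convolution) (use u u2 zero in \<open>auto simp: power2_eq_square fun_eq_iff\<close>)
    have v2: "weighted_form ?x ?y (2 * n) (\<lambda>s. (v s ^ 2) $ n)"
      unfolding power2_eq_square fps_mult_nth
      by (rule weighted_form_convolution) (use v zero in auto)
    have c2: "weighted_form ?x ?y (2 * n) (\<lambda>s. c 2 s * c (n - 2) s)"
    proof -
      have "2 * 2 + 2 * (n - 2) = 2 * n" using 5 by simp
      then show ?thesis
        using weighted_form_mult[OF less[of 2] less[of "n - 2"]] 5 by (simp only:)
    qed
    have "weighted_form ?x ?y (2 * n) (\<lambda>s. of_rat (1 / of_nat (2 * n + 1)) * ((v s ^ 2) $ n + of_rat (- 3) * (u s ^ 2) $ n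
        + of_rat (- 1) * (u s ^ 2 * u s) $ n + of_rat 5 * (c 2 s * c (n - 2) s)))"
      by (intro weighted_form_scale weighted_form_add v2 u2 u3 c2 odd_denom_inverse odd_denom_simps)
         (use odd_denom_of_int[of "-1"] in auto)
    also have "(\<lambda>s. of_rat (1 / of_nat (2 * n + 1)) * ((v s ^ 2) $ n + of_rat (- 3) * (u s ^ 2) $ n
        + of_rat (- 1) * (u s ^ 2 * u s) $ n + of_rat 5 * (c 2 s * c (n - 2) s))) = c n"
    proof
      fix s
      have "of_nat (2 * n + 1) * c n s = (v s ^ 2) $ n - 3 * (u s ^ 2) $ n - (u s ^ 2 * u s) $ n + 5 * c 2 s * c (n - 2) s"
        unfolding u_def v_def by (rule cubic_of_recurrence) (use c0 c1 rec 5 in auto)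
      moreover have "of_nat (2 * n + 1) \<noteq> (0 :: complex)"
        unfolding of_nat_eq_0_iff by simp
      ultimately show "of_rat (1 / of_nat (2 * n + 1)) * ((v s ^ 2) $ n + of_rat (- 3) * (u s ^ 2) $ n
        + of_rat (- 1) * (u s ^ 2 * u s) $ n + of_rat 5 * (c 2 s * c (n - 2) s)) = c n s"
        by (simp add: of_rat_divide of_rat_add field_simps del: of_nat_mult)
    qed
    finally show ?thesis .
  qed
qed

section \<open>Eisenstein series\<close>

lemma of_real_of_rat: "of_real (of_rat r) = (of_rat r :: complex)"
  by (cases r) (simp add: of_rat_rat)

lemma nome_exp: "Im z > 0 \<Longrightarrow> nome (exp (2 * of_real pi * \<i> * z))"
  by unfold_locales (simp add: norm_exp_eq_Re)

text \<open>Euler's formula turns the prefactor -B_k (2 pi i)^k / k! into 2 zeta(k).\<close>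

lemma eisenstein_G_eq_wp:
  assumes "Im z > 0" "even k" "k \<ge> 4"
  shows "(of_nat k - 1) * eisenstein_G k z = (2 * of_real pi * \<i>) ^ k * nome.wp_fps (exp (2 * of_real pi * \<i> * z)) $ k"
proof -
  define q where "q = exp (2 * of_real pi * \<i> * z)"
  interpret nome q unfolding q_def by (rule nome_exp[OF assms(1)])
  have "exp (2 * of_real pi * \<i> * of_nat (Suc n) * z) = q ^ Suc n" for n
    unfolding q_def by (simp only: exp_of_nat_mult[symmetric] mult_ac)
  then have E: "eisenstein_E k z = 1 - of_rat (2 * of_nat k / bernoulli k) * (\<Sum>n. of_nat (divisor_sigma (k - 1) (Suc n)) * q ^ Suc n)"
    by (simp only: eisenstein_E_def of_real_of_rat)
  have "(2 * of_real pi * \<i>) ^ k * wp_fps $ k =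
     - (of_nat k - 1) * (of_rat (bernoulli k) * (2 * of_real pi * \<i>) ^ k / fact k) * eisenstein_E k z"
    unfolding wp_fps_nth_even[OF assms(2,3)] E by (simp add: mult_ac)
  also have "of_rat (bernoulli k) * (2 * of_real pi * \<i>) ^ k / fact k = - of_real (2 * zeta_nat k)"
    using bernoulli_eq_zeta[of k] assms by simp
  finally show ?thesis
    by (simp add: eisenstein_G_def q_def algebra_simps)
qed

text \<open>The coefficient of t^(2n) in t^2 wp(t) for the lattice spanned by 1 and z. The slot n =
  1 is 0 since wp has no constant term, so G_2 never enters.\<close>

definition wp_coeff :: "nat \<Rightarrow> complex \<Rightarrow> complex" where
  "wp_coeff n z = (if n = 0 then 1 else if n = 1 then 0 else (2 * of_nat n - 1) * eisenstein_G (2 * n) z)"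

lemma wp_coeff_eq:
  assumes "Im z > 0"
  shows "wp_coeff n z = (2 * of_real pi * \<i>) ^ (2 * n) * nome.wp_fps (exp (2 * of_real pi * \<i> * z)) $ (2 * n)"
proof -
  interpret nome "exp (2 * of_real pi * \<i> * z)" by (rule nome_exp[OF assms])
  consider "n = 0" | "n = 1" | "n \<ge> 2" by linarith
  then show ?thesis
  proof cases
    case 3
    then show ?thesis
      using eisenstein_G_eq_wp[OF assms, of "2 * n"] by (simp add: wp_coeff_def)
  qed (simp_all add: wp_coeff_def wp_fps_nth_0 wp_fps_nth_2)
qed

text \<open>Odd coefficients vanish, so the convolution up to 2n runs over even indices only, and
  the factor (2 pi i)^(2n) is homogeneous; n = 2 is the exceptional degree 4.\<close>

lemma wp_coeff_recurrence:
  assumes "Im z > 0" "n \<noteq> 2"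
  shows "(2 * of_nat n - 3) * (2 * of_nat n - 2) * wp_coeff n z = 6 * (\<Sum>i\<le>n. wp_coeff i z * wp_coeff (n - i) z)"
proof -
  interpret nome "exp (2 * of_real pi * \<i> * z)" by (rule nome_exp[OF assms(1)])
  define p where "p = (2 * of_real pi * \<i> :: complex)"
  have "(\<Sum>i\<le>2 * n. wp_fps $ i * wp_fps $ (2 * n - i)) = (\<Sum>i\<in>(\<lambda>i. 2 * i) ` {..n}. wp_fps $ i * wp_fps $ (2 * n - i))"
  proof (rule sum.mono_neutral_right)
    show "\<forall>i\<in>{..2 * n} - (\<lambda>i. 2 * i) ` {..n}. wp_fps $ i * wp_fps $ (2 * n - i) = 0"
    proof
      fix i assume i: "i \<in> {..2 * n} - (\<lambda>i. 2 * i) ` {..n}"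
      have "odd i"
      proof
        assume "even i"
        then obtain j where "i = 2 * j" by (elim evenE)
        with i show False by auto
      qed
      then show "wp_fps $ i * wp_fps $ (2 * n - i) = 0"
        by (simp add: wp_fps_nth_odd)
    qed
  qed auto
  also have "\<dots> = (\<Sum>i\<le>n. wp_fps $ (2 * i) * wp_fps $ (2 * (n - i)))"
    by (subst sum.reindex) (auto simp: inj_on_def diff_mult_distrib2)
  finally have s: "(\<Sum>i\<le>2 * n. wp_fps $ i * wp_fps $ (2 * n - i)) = (\<Sum>i\<le>n. wp_fps $ (2 * i) * wp_fps $ (2 * (n - i)))" .
  have "(\<Sum>i\<le>n. wp_coeff i z * wp_coeff (n - i) z) = (\<Sum>i\<le>n. p ^ (2 * n) * (wp_fps $ (2 * i) * wp_fps $ (2 * (n - i))))"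
  proof (rule sum.cong)
    fix i assume "i \<in> {..n}"
    then have "2 * n = 2 * i + 2 * (n - i)" by simp
    then have "p ^ (2 * n) = p ^ (2 * i) * p ^ (2 * (n - i))"
      by (simp only: power_add)
    then show "wp_coeff i z * wp_coeff (n - i) z = p ^ (2 * n) * (wp_fps $ (2 * i) * wp_fps $ (2 * (n - i)))"
      by (simp add: wp_coeff_eq[OF assms(1)] p_def)
  qed simp
  also have "6 * \<dots> = p ^ (2 * n) * (6 * (\<Sum>i\<le>2 * n. wp_fps $ i * wp_fps $ (2 * n - i)))"
    by (simp add: s sum_distrib_left[symmetric])
  also have "6 * (\<Sum>i\<le>2 * n. wp_fps $ i * wp_fps $ (2 * n - i)) = (2 * of_nat n - 3) * (2 * of_nat n - 2) * wp_fps $ (2 * n)"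
    using wp_fps_recurrence[of "2 * n"] assms(2) by simp
  finally show ?thesis
    by (simp add: wp_coeff_eq[OF assms(1)] p_def)
qed

text \<open>Passing from c(n) = (2n - 1) G_{2n} to G_{2n} divides by an odd number, which keeps the
  coefficients 2-integral.\<close>

lemma G_expansion_odd_denom:
  assumes "k \<ge> 4" "even k"
  shows "\<exists>w. G_expansion k w \<and> (\<forall>a. odd_denom (w a))"
proof -
  obtain n where k: "k = 2 * n" "n \<ge> 2"
    using assms by (auto elim!: evenE)
  \<comment> \<open>A parametrization of the upper half-plane by the whole plane, as forms are functions on a type.\<close>
  define h where "h s = Complex (Re s) (exp (Im s))" for s
  have h: "Im (h s) > 0" for s by (simp add: h_def)
  have h': "h (Complex (Re z) (ln (Im z))) = z" if "Im z > 0" for z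
    using that by (simp add: h_def)
  have "weighted_form (\<lambda>s. wp_coeff 2 (h s) / 3) (\<lambda>s. wp_coeff 3 (h s) / 5) (2 * n) (\<lambda>s. wp_coeff n (h s))"
    using weighted_form_of_recurrence[of "\<lambda>n s. wp_coeff n (h s)" n] wp_coeff_recurrence[OF h]
    by (simp add: wp_coeff_def)
  then have "weighted_form (\<lambda>s. eisenstein_G 4 (h s)) (\<lambda>s. eisenstein_G 6 (h s)) (2 * n) (\<lambda>s. wp_coeff n (h s))"
    by (simp add: wp_coeff_def)
  then have "weighted_form (\<lambda>s. eisenstein_G 4 (h s)) (\<lambda>s. eisenstein_G 6 (h s)) (2 * n)
     (\<lambda>s. of_rat (1 / of_nat (2 * n - 1)) * wp_coeff n (h s))"
    by (rule weighted_form_scale) (rule odd_denom_inverse, use k in simp)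
  moreover have "of_rat (1 / of_nat (2 * n - 1)) * wp_coeff n z = eisenstein_G k z" for z
  proof -
    have "of_nat (2 * n - 1) \<noteq> (0 :: complex)"
      unfolding of_nat_eq_0_iff using k by simp
    moreover have "wp_coeff n z = of_nat (2 * n - 1) * eisenstein_G k z"
      using k by (simp add: wp_coeff_def of_nat_diff)
    ultimately show ?thesis
      by (simp add: of_rat_divide del: of_nat_diff)
  qed
  ultimately have "weighted_form (\<lambda>s. eisenstein_G 4 (h s)) (\<lambda>s. eisenstein_G 6 (h s)) k (\<lambda>s. eisenstein_G k (h s))"
    by (simp add: k)
  from weighted_form_expand[OF this] obtain w where w: "\<And>a. odd_denom (w a)"
    "\<And>s. eisenstein_G k (h s) = (\<Sum>a\<in>exps_46 k. of_rat (w a) * eisenstein_G 4 (h s) ^ a * eisenstein_G 6 (h s) ^ ((k - 4 * a) div 6))"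
    by blast
  have "G_expansion k w"
    unfolding G_expansion_def
  proof (intro allI impI)
    fix z :: complex assume "Im z > 0"
    then show "eisenstein_G k z = (\<Sum>a\<in>exps_46 k. of_rat (w a) * eisenstein_G 4 z ^ a * eisenstein_G 6 z ^ ((k - 4 * a) div 6))"
      using w(2)[of "Complex (Re z) (ln (Im z))"] by (simp only: h')
  qed
  with w(1) show ?thesis by blast
qed

section \<open>Uniqueness of the expansion, via the imaginary axis\<close>

definition sigma_series :: "nat \<Rightarrow> real \<Rightarrow> real" where
  "sigma_series j x = (\<Sum>n. real (divisor_sigma j (Suc n)) * x ^ Suc n)"

lemma summable_sigma_series:
  assumes "0 < x" "x < 1"
  shows "summable (\<lambda>n. real (divisor_sigma j (Suc n)) * x ^ Suc n)"
proof -
  interpret nome "of_real x" by unfold_locales (use assms in auto)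
  have "summable (\<lambda>n. complex_of_real (real (divisor_sigma j (Suc n)) * x ^ Suc n))"
    using has_sum_imp_sums[OF lambert_series[of j]] by (auto simp: sums_iff simp del: power_Suc)
  then show ?thesis
    unfolding summable_complex_of_real .
qed

lemma divisor_sigma_pos: "divisor_sigma j (Suc n) > 0"
proof -
  have "1 ^ j \<le> divisor_sigma j (Suc n)"
    unfolding divisor_sigma_def by (rule member_le_sum) (auto intro: finite_divisors_nat)
  then show ?thesis by simp
qed

lemma sigma_series_strict_mono:
  assumes "0 < x" "x < y" "y < 1"
  shows "sigma_series j x < sigma_series j y"
proof -
  have "0 < (\<Sum>n. real (divisor_sigma j (Suc n)) * y ^ Suc n - real (divisor_sigma j (Suc n)) * x ^ Suc n)"
  proof (rule suminf_pos)
    fix n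
    have "x ^ Suc n < y ^ Suc n"
      using assms by (intro power_strict_mono) auto
    then show "0 < real (divisor_sigma j (Suc n)) * y ^ Suc n - real (divisor_sigma j (Suc n)) * x ^ Suc n"
      using divisor_sigma_pos[of j n] by simp
  qed (use assms in \<open>intro summable_diff summable_sigma_series; simp\<close>)
  then show ?thesis
    unfolding sigma_series_def using assms
    by (subst (asm) suminf_diff[symmetric]) (auto intro: summable_sigma_series simp del: power_Suc)
qed

lemma sigma_series_pos:
  assumes "0 < x" "x < 1"
  shows "sigma_series j x > 0"
  unfolding sigma_series_def
  by (rule suminf_pos[OF summable_sigma_series[OF assms]]) (use assms divisor_sigma_pos in simp)

text \<open>A bound linear in x, used to keep G_6 positive near the cusp x = 0.\<close>

lemma sigma_series_le:
  assumes "0 < x" "x \<le> 1/2"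
  shows "sigma_series j x \<le> 2 * x * sigma_series j (1/2)"
proof -
  have "sigma_series j x \<le> (\<Sum>n. 2 * x * (real (divisor_sigma j (Suc n)) * (1/2) ^ Suc n))"
    unfolding sigma_series_def
  proof (rule suminf_le)
    fix n
    have "x * x ^ n \<le> x * (1/2) ^ n"
      using assms by (intro mult_left_mono power_mono) auto
    then have "x ^ Suc n \<le> 2 * x * (1/2) ^ Suc n" by simp
    then have "real (divisor_sigma j (Suc n)) * x ^ Suc n \<le> real (divisor_sigma j (Suc n)) * (2 * x * (1/2) ^ Suc n)"
      by (rule mult_left_mono) simp
    then show "real (divisor_sigma j (Suc n)) * x ^ Suc n \<le> 2 * x * (real (divisor_sigma j (Suc n)) * (1/2) ^ Suc n)"
      by (simp only: mult_ac)
  qed (use assms in \<open>intro summable_mult summable_sigma_series; simp\<close>)+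
  also have "\<dots> = 2 * x * sigma_series j (1/2)"
    unfolding sigma_series_def by (rule suminf_mult) (rule summable_sigma_series; simp)
  finally show ?thesis .
qed

text \<open>At this point of the imaginary axis q equals the real number x, so the value is
  real.\<close>

lemma eisenstein_G_imaginary_axis:
  assumes "0 < x" "x < 1" "k \<ge> 1"
  shows "eisenstein_G k (Complex 0 (- ln x / (2 * pi))) =
    of_real (2 * zeta_nat k * (1 - of_rat (2 * of_nat k / bernoulli k) * sigma_series (k - 1) x))"
proof -
  define z where "z = Complex 0 (- ln x / (2 * pi))"
  have "2 * of_real pi * \<i> * z = of_real (ln x)"
    by (simp add: z_def complex_eq_iff)
  then have "exp (2 * of_real pi * \<i> * z) = of_real x"
    using assms by (simp add: exp_of_real)
  moreover have "exp (2 * of_real pi * \<i> * of_nat (Suc n) * z) = exp (2 * of_real pi * \<i> * z) ^ Suc n" for n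
    by (simp only: exp_of_nat_mult[symmetric] mult_ac)
  ultimately have "exp (2 * of_real pi * \<i> * of_nat (Suc n) * z) = of_real (x ^ Suc n)" for n
    by (simp only: of_real_power)
  then have "(\<Sum>n. of_nat (divisor_sigma (k - 1) (Suc n)) * exp (2 * of_real pi * \<i> * of_nat (Suc n) * z)) =
     (\<Sum>n. complex_of_real (real (divisor_sigma (k - 1) (Suc n)) * x ^ Suc n))"
    by (simp only: of_real_mult of_real_of_nat_eq)
  also have "\<dots> = of_real (sigma_series (k - 1) x)"
    unfolding sigma_series_def
    by (rule suminf_of_real[symmetric]) (rule summable_sigma_series[OF assms(1,2)])
  finally show ?thesis
    unfolding eisenstein_G_def eisenstein_E_def z_def[symmetric] by simp
qed

lemma bernoulli_4: "bernoulli 4 = - 1 / 30" and bernoulli_6: "bernoulli 6 = 1 / 42"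
  by (simp_all add: bernoulli_def eval_nat_numeral Let_def)

text \<open>On 4a + 6b = k one has f^a g^b = r^a g^(k/6) with r = f g^(-2/3). The difference of two
  expansions is thus a polynomial in \<open>r\<close> times a nonzero factor, and it has infinitely
  many roots because f increases while g decreases.\<close>

lemma G_expansion_unique:
  assumes "G_expansion k w" "G_expansion k w'" "a \<in> exps_46 k"
  shows "w a = w' a"
proof -
  \<comment> \<open>240 and -504 are -2k / B_k for k = 4 and k = 6; their opposite signs make
    \<open>r\<close> monotone.\<close>
  define f where "f x = 2 * zeta_nat 4 * (1 + 240 * sigma_series 3 x)" for x
  define g where "g x = 2 * zeta_nat 6 * (1 - 504 * sigma_series 5 x)" for x
  define D where "D a = real_of_rat (w a - w' a)" for a
  define p where "p = (\<Sum>a\<in>exps_46 k. monom (D a) a)"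
  define r where "r x = f x * g x powr (- 2 / 3)" for x
  \<comment> \<open>2016 = 4 * 504: below \<open>x0\<close>, \<open>sigma_series_le\<close> gives
    504 \<open>sigma_series 5 x\<close> < 1/2, so \<open>g\<close> is positive.\<close>
  define x0 :: real where "x0 = min (1/2) (1 / (2016 * sigma_series 5 (1/2)))"
  have s5: "sigma_series 5 (1/2) > 0" by (rule sigma_series_pos) auto
  have x0: "0 < x0" "x0 \<le> 1/2" using s5 by (auto simp: x0_def)
  have z46: "zeta_nat 4 > 0" "zeta_nat 6 > 0" by (simp_all add: zeta_nat_pos)
  have fpos: "f x > 0" if "0 < x" "x < x0" for x
    using sigma_series_pos[of x 3] that x0 z46 by (simp add: f_def)
  have gpos: "g x > 0" if "0 < x" "x < x0" for x
  proof -
    have "x * (2016 * sigma_series 5 (1/2)) < 1"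
      using that s5 by (simp add: x0_def field_simps)
    moreover have "sigma_series 5 x \<le> 2 * x * sigma_series 5 (1/2)"
      using that x0 by (intro sigma_series_le) auto
    ultimately have "504 * sigma_series 5 x < 1" by (simp add: algebra_simps)
    then show ?thesis using z46 by (simp add: g_def)
  qed
  have mono: "r x < r y" if "0 < x" "x < y" "y < x0" for x y
  proof -
    have "f x < f y"
      using sigma_series_strict_mono[of x y 3] that x0 z46 by (simp add: f_def)
    moreover have "g y < g x"
      using sigma_series_strict_mono[of x y 5] that x0 z46 by (simp add: g_def)
    then have "g x powr (- 2 / 3) < g y powr (- 2 / 3)"
      using gpos[of y] that by (intro powr_less_mono2_neg) auto
    ultimately show ?thesis
      unfolding r_def using fpos[of x] that by (intro mult_strict_mono) auto
  qed
  have inj: "inj_on r {0<..<x0}"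
    by (rule linorder_inj_onI) (use mono in \<open>force+\<close>)
  have root: "poly p (r x) = 0" if x: "0 < x" "x < x0" for x
  proof -
    define z where "z = Complex 0 (- ln x / (2 * pi))"
    have x1: "x < 1" using x x0 by simp
    have z: "Im z > 0"
      using x x1 by (simp add: z_def divide_neg_pos)
    have G4: "eisenstein_G 4 z = of_real (f x)" and G6: "eisenstein_G 6 z = of_real (g x)"
      unfolding z_def using eisenstein_G_imaginary_axis[OF x(1) x1, of 4] eisenstein_G_imaginary_axis[OF x(1) x1, of 6]
      by (simp_all add: f_def g_def bernoulli_4 bernoulli_6 of_rat_divide)
    have "(\<Sum>a\<in>exps_46 k. of_rat (w a) * eisenstein_G 4 z ^ a * eisenstein_G 6 z ^ ((k - 4 * a) div 6)) =
        (\<Sum>a\<in>exps_46 k. of_rat (w' a) * eisenstein_G 4 z ^ a * eisenstein_G 6 z ^ ((k - 4 * a) div 6))"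
      using assms(1,2) z by (simp add: G_expansion_def)
    then have "(\<Sum>a\<in>exps_46 k. of_rat (w a - w' a) * eisenstein_G 4 z ^ a * eisenstein_G 6 z ^ ((k - 4 * a) div 6)) = 0"
      by (simp add: of_rat_diff left_diff_distrib sum_subtractf)
    then have "complex_of_real (\<Sum>a\<in>exps_46 k. D a * f x ^ a * g x ^ ((k - 4 * a) div 6)) = 0"
      by (simp add: G4 G6 D_def of_real_of_rat)
    then have "(\<Sum>a\<in>exps_46 k. D a * f x ^ a * g x ^ ((k - 4 * a) div 6)) = 0"
      by (simp only: of_real_eq_0_iff)
    moreover have "(\<Sum>a\<in>exps_46 k. D a * f x ^ a * g x ^ ((k - 4 * a) div 6)) = poly p (r x) * g x powr (real k / 6)"
    proof -
      have "f x ^ a * g x ^ ((k - 4 * a) div 6) = r x ^ a * g x powr (real k / 6)" if "a \<in> exps_46 k" for a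
      proof -
        obtain b where b: "k - 4 * a = 6 * b" "4 * a \<le> k"
          using \<open>a \<in> exps_46 k\<close> by (auto simp: exps_46_def)
        then have k: "real k = 4 * real a + 6 * real b"
          by (metis le_add_diff_inverse of_nat_add of_nat_mult of_nat_numeral)
        have "r x ^ a * g x powr (real k / 6) = f x ^ a * (g x powr (- 2 / 3 * real a) * g x powr (real k / 6))"
          using gpos[OF x] by (simp add: r_def power_mult_distrib powr_power mult_ac)
        \<comment> \<open>The exponents add up to -2a/3 + (4a + 6b)/6 = b.\<close>
        also have "g x powr (- 2 / 3 * real a) * g x powr (real k / 6) = g x powr real b"
          unfolding powr_add[symmetric] by (rule arg_cong[of _ _ "\<lambda>t. g x powr t"]) (simp add: k field_simps)
        also have "\<dots> = g x ^ ((k - 4 * a) div 6)"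
          using gpos[OF x] b by (simp add: powr_realpow)
        finally show ?thesis ..
      qed
      then show ?thesis
        by (simp add: p_def poly_sum poly_monom sum_distrib_right mult.assoc)
    qed
    ultimately show ?thesis
      using gpos[OF x] by simp
  qed
  have "p = 0"
  proof (rule ccontr)
    assume "p \<noteq> 0"
    then have "finite {y. poly p y = 0}" by (rule poly_roots_finite)
    then have "finite (r ` {0<..<x0})"
      by (rule finite_subset[rotated]) (use root in auto)
    then have "finite {0<..<x0}"
      using inj by (rule finite_imageD)
    then show False
      using infinite_Ioo[OF x0(1)] by simp
  qed
  then have "coeff p a = 0" by simp
  then have "D a = 0"
    using assms(3) finite_exps_46 by (simp add: p_def coeff_sum)
  then show ?thesis by (simp add: D_def)
qed

theorem theorem4p1:
  fixes k :: nat
  assumes "k \<ge> 4" and "even k"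
  shows "(\<exists>w. G_expansion k w) \<and>
         (\<forall>w. G_expansion k w \<longrightarrow>
            (\<forall>a\<in>exps_46 k. w a \<noteq> 0 \<longrightarrow> padic_val_rat 2 (w a) \<ge> 0))"
proof -
  obtain w0 where "G_expansion k w0" "\<And>a. odd_denom (w0 a)"
    using G_expansion_odd_denom[OF assms] by blast
  then show ?thesis
    using G_expansion_unique[of k _ w0] padic_val_rat_2_nonneg by metis
qed

end
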